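(* Let $R=\mathbb{K}$ be a field, and let $\{K_i\}_{1\le i\le n}$ be an interaction simplicial complex. Then the map $$\psi:H^*(\{K_i\}_{1\le i\le n})\to\mathrm{Hom}_{\mathbb{K}}(H_*(\{K_i\}_{1\le i\le n}),\mathbb{K}),\qquad \psi([f])[z]=f(z),$$ from interaction cohomology to the dual of interaction simplicial homology is an isomorphism.
   Context: An interaction simplicial complex $(K,\{K_i\}_{1\le i\le n})$ is a simplicial complex $K$ with subcomplexes $K_i$ such that $K=\bigcup_{i=1}^nK_i$; it is also written $\{K_i\}_{1\le i\le n}$. Let $C_*(K_i)$ be the simplicial chain complex over $R$. The complex $\bigotimes_{i=1}^nC_*(K_i)$ (tensor over $R$) has differential $d(\sigma_1\otimes\cdots\otimes\sigma_n)=\sum_{i=1}^n(-1)^{\dim\sigma_1+\cdots+\dim\sigma_{i-1}}\sigma_1\otimes\cdots\otimes d\sigma_i\otimes\cdots\otimes\sigma_n$. Let $D_*(\{K_i\})$ be the subcomplex generated as an $R$-module by the $\sigma_1\otimes\cdots\otimes\sigma_n$ with $\sigma_i\in K_i$ and $\bigcap_{i=1}^n\sigma_i=\emptyset$. The interaction chain complex is $IC_*(\{K_i\})=\left(\bigotimes_{i=1}^nC_*(K_i)\right)/D_*(\{K_i\})$, and the interaction simplicial homology is $H_p(\{K_i\})=H_p(IC_*(\{K_i\}))$. An interaction cochain on $\{K_i\}$ is an $R$-module homomorphism $f:C_*(K_1)\otimes\cdots\otimes C_*(K_n)\to R$ with $f(\sigma_1\otimes\cdots\otimes\sigma_n)=0$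 whenever $\sigma_i\in K_i$ and $\bigcap_{i=1}^n\sigma_i=\emptyset$. An interaction cochain of the form $f:C_{p_1}(K_1)\otimes\cdots\otimes C_{p_n}(K_n)\to R$ with $p=\sum_ip_i$ is an interaction $p$-cochain, and $IC^p(\{K_i\})$ is the $R$-module generated by the interaction $p$-cochains. The differential is $d(f)=-(-1)^{\deg f}f\circ d$, giving a cochain complex $IC^*(\{K_i\})$; the interaction cohomology is $H^p(\{K_i\})=H^p(IC^*(\{K_i\}))$. In the formula for $\psi$, $z$ represents a cycle of $IC_*(\{K_i\})$ and $f(z)$ is the value of the cocycle $f$ on any lift of it to $\bigotimes_iC_*(K_i)$ (well defined because $f$ vanishes on $D_*(\{K_i\})$). $\mathrm{Hom}_{\mathbb{K}}(H_*,\mathbb{K})$ is taken degreewise. *)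

theory Defs
  imports
    Complex_Main
    "HOL-Algebra.Module"
    "HOL-Algebra.AbelCoset"
    "HOL-Library.Poly_Mapping"
    "HOL-Library.Function_Algebras"
begin

section \<open>Modules as objects\<close>

text \<open>
  The scalars are the elements of a type of class \<^class>\<open>comm_ring_1\<close>.  Modules that have to be
  handled as objects (quotients, homology, duals) are records of type \<open>('k, 'm) module\<close>, whose
  multiplicative fields \<open>mult\<close> and \<open>one\<close> are never used.
\<close>

definition module_on ::
    "'m::ab_group_add set \<Rightarrow> ('k::comm_ring_1 \<Rightarrow> 'm \<Rightarrow> 'm) \<Rightarrow> ('k, 'm) module" where
  "module_on A s =
    \<lparr>carrier = A, mult = undefined, one = undefined, zero = 0, add = (+), smult = s\<rparr>"

definition quotient_module :: "('k, 'm) module \<Rightarrow> 'm set \<Rightarrow> ('k, 'm set) module" where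
  "quotient_module M N =
    \<lparr>carrier = a_rcosets\<^bsub>M\<^esub> N, mult = undefined, one = undefined, zero = N, add = set_add M,
     smult = (\<lambda>a X. \<Union>x\<in>X. N +>\<^bsub>M\<^esub> (a \<odot>\<^bsub>M\<^esub> x))\<rparr>"

definition lin_hom :: "('k, 'm) module \<Rightarrow> ('k, 'l) module \<Rightarrow> ('m \<Rightarrow> 'l) set" where
  "lin_hom M N = {h \<in> hom (add_monoid M) (add_monoid N).
     \<forall>a. \<forall>x\<in>carrier M. h (a \<odot>\<^bsub>M\<^esub> x) = a \<odot>\<^bsub>N\<^esub> h x}"

definition lin_iso :: "('k, 'm) module \<Rightarrow> ('k, 'l) module \<Rightarrow> ('m \<Rightarrow> 'l) set" where
  "lin_iso M N = {h \<in> lin_hom M N. bij_betw h (carrier M) (carrier N)}"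

text \<open>
  A functional on \<open>M\<close> is represented by a function that is \<open>0\<close> outside the carrier of \<open>M\<close>, so that
  equality of functionals on \<open>M\<close> is equality of functions.
\<close>

definition fun_scale :: "'k::comm_ring_1 \<Rightarrow> ('m \<Rightarrow> 'k) \<Rightarrow> 'm \<Rightarrow> 'k" where
  "fun_scale a \<phi> = (\<lambda>x. a * \<phi> x)"

definition dual_module :: "('k::comm_ring_1, 'm) module \<Rightarrow> ('k, 'm \<Rightarrow> 'k) module" where
  "dual_module M =
    module_on {\<phi> \<in> lin_hom M (module_on UNIV (*)). \<forall>x. x \<notin> carrier M \<longrightarrow> \<phi> x = 0} fun_scale"

text \<open>
  A complex consists of modules \<open>C p\<close> and maps \<open>d p\<close> from \<open>C p\<close> to \<open>C (p + e)\<close>, for all integers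
  \<open>p\<close>; \<open>e = -1\<close> for chain complexes and \<open>e = 1\<close> for cochain complexes.
\<close>

definition cycles :: "(int \<Rightarrow> ('k, 'm) module) \<Rightarrow> (int \<Rightarrow> 'm \<Rightarrow> 'm) \<Rightarrow> int \<Rightarrow> int \<Rightarrow> 'm set" where
  "cycles C d e p = {x \<in> carrier (C p). d p x = \<zero>\<^bsub>C (p + e)\<^esub>}"

definition boundaries :: "(int \<Rightarrow> ('k, 'm) module) \<Rightarrow> (int \<Rightarrow> 'm \<Rightarrow> 'm) \<Rightarrow> int \<Rightarrow> int \<Rightarrow> 'm set" where
  "boundaries C d e p = d (p - e) ` carrier (C (p - e))"

definition homology ::
    "(int \<Rightarrow> ('k, 'm) module) \<Rightarrow> (int \<Rightarrow> 'm \<Rightarrow> 'm) \<Rightarrow> int \<Rightarrow> int \<Rightarrow> ('k, 'm set) module" where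
  "homology C d e p =
    quotient_module (C p\<lparr>carrier := cycles C d e p\<rparr>) (boundaries C d e p)"


section \<open>Interaction simplicial complexes\<close>

text \<open>Simplices are nonempty finite sets of vertices; a complex may be infinite.\<close>

definition simplicial_complex :: "'v set set \<Rightarrow> bool" where
  "simplicial_complex K \<longleftrightarrow>
    (\<forall>\<sigma>\<in>K. finite \<sigma> \<and> \<sigma> \<noteq> {}) \<and> (\<forall>\<sigma>\<in>K. \<forall>\<tau>\<subseteq>\<sigma>. \<tau> \<noteq> {} \<longrightarrow> \<tau> \<in> K)"

definition interaction_complex :: "nat \<Rightarrow> 'v set set \<Rightarrow> (nat \<Rightarrow> 'v set set) \<Rightarrow> bool" where
  "interaction_complex n K Ks \<longleftrightarrow> n \<ge> 1 \<and> simplicial_complex K \<and>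
    (\<forall>i\<in>{1..n}. simplicial_complex (Ks i) \<and> Ks i \<subseteq> K) \<and> K = (\<Union>i\<in>{1..n}. Ks i)"

definition sdim :: "'v set \<Rightarrow> int" where
  "sdim \<sigma> = int (card \<sigma>) - 1"


section \<open>Simplicial chains and their tensor products\<close>

text \<open>The free module on the elements of a type \<open>'a\<close> is the type \<open>'a \<Rightarrow>\<^sub>0 'k\<close>.\<close>

definition chain_scale :: "'k::comm_ring_1 \<Rightarrow> ('a \<Rightarrow>\<^sub>0 'k) \<Rightarrow> ('a \<Rightarrow>\<^sub>0 'k)" where
  "chain_scale a c = Poly_Mapping.map ((*) a) c"

definition lin_ext :: "('a \<Rightarrow> ('b \<Rightarrow>\<^sub>0 'k)) \<Rightarrow> ('a \<Rightarrow>\<^sub>0 'k) \<Rightarrow> ('b \<Rightarrow>\<^sub>0 'k::comm_ring_1)" where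
  "lin_ext \<phi> c = (\<Sum>x\<in>Poly_Mapping.keys c. chain_scale (Poly_Mapping.lookup c x) (\<phi> x))"

definition pm_one :: "int \<Rightarrow> 'k::comm_ring_1" where
  "pm_one m = (if even m then 1 else - 1)"

definition simp_chains :: "'v set set \<Rightarrow> ('v set \<Rightarrow>\<^sub>0 'k::comm_ring_1) set" where
  "simp_chains K = {c. Poly_Mapping.keys c \<subseteq> K}"

definition simp_chains_deg :: "int \<Rightarrow> 'v set set \<Rightarrow> ('v set \<Rightarrow>\<^sub>0 'k::comm_ring_1) set" where
  "simp_chains_deg q K = simp_chains {\<sigma> \<in> K. sdim \<sigma> = q}"

text \<open>
  Simplices are oriented by a linear order \<open>r\<close> of the vertices: for \<open>\<sigma> = {v\<^sub>0 < \<dots> < v\<^sub>q}\<close> the face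
  opposite to \<open>v\<^sub>j\<close> has coefficient \<open>(-1)^j\<close>, where \<open>j\<close> is the number of vertices of \<open>\<sigma>\<close> below
  \<open>v\<^sub>j\<close>.  The empty face is left out: the boundary of a vertex is \<open>0\<close>.
\<close>

definition boundary :: "'v rel \<Rightarrow> 'v set \<Rightarrow> ('v set \<Rightarrow>\<^sub>0 'k::comm_ring_1)" where
  "boundary r \<sigma> = (\<Sum>v | v \<in> \<sigma> \<and> \<sigma> - {v} \<noteq> {}.
     Poly_Mapping.single (\<sigma> - {v}) (pm_one (int (card {u \<in> \<sigma>. u \<noteq> v \<and> (u, v) \<in> r}))))"

text \<open>
  The tensor product of the free modules \<open>simp_chains (Ks i)\<close>, \<open>i = 1, \<dots>, n\<close>, is realised inside the free
  module on families \<open>(\<sigma>\<^sub>1, \<dots>, \<sigma>\<^sub>n)\<close>, which are extensional functions on \<open>{1..n}\<close>.  There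
  \<open>tensor n c\<close> is the pure tensor \<open>c\<^sub>1 \<otimes> \<dots> \<otimes> c\<^sub>n\<close>; the theorem \<open>tensor_product_universal\<close> below is
  the universal property.
\<close>

type_synonym ('v, 'k) tens = "(nat \<Rightarrow> 'v set) \<Rightarrow>\<^sub>0 'k"

definition tensor :: "nat \<Rightarrow> (nat \<Rightarrow> ('v set \<Rightarrow>\<^sub>0 'k)) \<Rightarrow> ('v, 'k::comm_ring_1) tens" where
  "tensor n c = (\<Sum>s \<in> (\<Pi>\<^sub>E i\<in>{1..n}. Poly_Mapping.keys (c i)).
     Poly_Mapping.single s (\<Prod>i\<in>{1..n}. Poly_Mapping.lookup (c i) (s i)))"

definition tensor_product ::
    "nat \<Rightarrow> (nat \<Rightarrow> 'v set set) \<Rightarrow> ('v, 'k::comm_ring_1) tens set" where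
  "tensor_product n Ks = Modules.module.span chain_scale {tensor n c | c. \<forall>i\<in>{1..n}. c i \<in> simp_chains (Ks i)}"

lemma lookup_chain_scale:
  "Poly_Mapping.lookup (chain_scale a c) x = a * Poly_Mapping.lookup c x"
  by (auto simp: chain_scale_def Poly_Mapping.map.rep_eq when_def)

lemma module_chain_scale: "Modules.module (chain_scale :: 'k::comm_ring_1 \<Rightarrow> ('a \<Rightarrow>\<^sub>0 'k) \<Rightarrow> _)"
  by unfold_locales
    (auto intro!: poly_mapping_eqI simp: lookup_chain_scale lookup_add algebra_simps)

lemma module_fun_scale: "Modules.module (fun_scale :: 'k::comm_ring_1 \<Rightarrow> ('m \<Rightarrow> 'k) \<Rightarrow> _)"
  by unfold_locales (auto simp: fun_scale_def fun_eq_iff algebra_simps)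

lemma lookup_tensor:
  "Poly_Mapping.lookup (tensor n c) s =
    (if s \<in> extensional {1..n} then \<Prod>i\<in>{1..n}. Poly_Mapping.lookup (c i) (s i) else 0)"
proof -
  let ?A = "\<Pi>\<^sub>E i\<in>{1..n}. Poly_Mapping.keys (c i)"
  have fin: "finite ?A" by (intro finite_PiE) auto
  have "Poly_Mapping.lookup (tensor n c) s =
      (\<Sum>t\<in>?A. if t = s then \<Prod>i\<in>{1..n}. Poly_Mapping.lookup (c i) (t i) else 0)"
    unfolding tensor_def lookup_sum lookup_single when_def by simp
  also have "\<dots> = (if s \<in> ?A then \<Prod>i\<in>{1..n}. Poly_Mapping.lookup (c i) (s i) else 0)"
    using fin by (simp add: sum.delta)
  also have "\<dots> = (if s \<in> extensional {1..n}
      then \<Prod>i\<in>{1..n}. Poly_Mapping.lookup (c i) (s i) else 0)"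
    using prod_zero[of "{1..n}" "\<lambda>i. Poly_Mapping.lookup (c i) (s i)"]
    by (auto simp: PiE_iff in_keys_iff)
  finally show ?thesis .
qed

lemma prod_upd:
  fixes g :: "nat \<Rightarrow> 'x \<Rightarrow> 'k::comm_ring_1"
  assumes "i \<in> {1..n::nat}"
  shows "(\<Prod>j\<in>{1..n}. Poly_Mapping.lookup ((c(i := x)) j) (s j)) =
    Poly_Mapping.lookup x (s i) * (\<Prod>j\<in>{1..n} - {i}. Poly_Mapping.lookup (c j) (s j))"
  using assms by (subst prod.remove[of _ i]) (auto intro!: prod.cong)

lemma tensor_add:
  "i \<in> {1..n} \<Longrightarrow> tensor n (c(i := x + y)) = tensor n (c(i := x)) + tensor n (c(i := y))"
  by (rule poly_mapping_eqI)
    (auto simp only: lookup_tensor lookup_add prod_upd distrib_right if_True if_False add_0 split: if_splits)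

lemma tensor_scale:
  "i \<in> {1..n} \<Longrightarrow> tensor n (c(i := chain_scale a x)) = chain_scale a (tensor n (c(i := x)))"
  by (rule poly_mapping_eqI)
    (auto simp only: lookup_tensor lookup_chain_scale prod_upd mult.assoc if_True if_False mult_zero_right split: if_splits)

lemma tensor_cong: "(\<And>i. i \<in> {1..n} \<Longrightarrow> c i = c' i) \<Longrightarrow> tensor n c = tensor n c'"
  by (rule poly_mapping_eqI) (simp add: lookup_tensor)

theorem tensor_product_universal:
  fixes m :: "(nat \<Rightarrow> ('v set \<Rightarrow>\<^sub>0 'k::comm_ring_1)) \<Rightarrow> 'w::ab_group_add"
    and scl :: "'k \<Rightarrow> 'w \<Rightarrow> 'w"
  assumes W: "Modules.module scl"
    and cong: "\<And>c c'. (\<And>i. i \<in> {1..n} \<Longrightarrow> c i = c' i) \<Longrightarrow> m c = m c'"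
    and add: "\<And>c i x y. (\<And>j. j \<in> {1..n} \<Longrightarrow> c j \<in> simp_chains (Ks j)) \<Longrightarrow> i \<in> {1..n} \<Longrightarrow>
      x \<in> simp_chains (Ks i) \<Longrightarrow> y \<in> simp_chains (Ks i) \<Longrightarrow>
      m (c(i := x + y)) = m (c(i := x)) + m (c(i := y))"
    and scal: "\<And>c i a x. (\<And>j. j \<in> {1..n} \<Longrightarrow> c j \<in> simp_chains (Ks j)) \<Longrightarrow> i \<in> {1..n} \<Longrightarrow>
      x \<in> simp_chains (Ks i) \<Longrightarrow> m (c(i := chain_scale a x)) = scl a (m (c(i := x)))"
  shows "\<exists>!L. L \<in> lin_hom (module_on (tensor_product n Ks) chain_scale) (module_on UNIV scl) \<and>
    (\<forall>t. t \<notin> tensor_product n Ks \<longrightarrow> L t = 0) \<and>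
    (\<forall>c. (\<forall>i\<in>{1..n}. c i \<in> simp_chains (Ks i)) \<longrightarrow> L (tensor n c) = m c)"
proof -
  interpret W: Modules.module scl by (rule W)
  interpret T: Modules.module "chain_scale :: 'k \<Rightarrow> ('v, 'k) tens \<Rightarrow> _" by (rule module_chain_scale)
  interpret C: Modules.module "chain_scale :: 'k \<Rightarrow> ('v set \<Rightarrow>\<^sub>0 'k) \<Rightarrow> _" by (rule module_chain_scale)
  let ?lk = "Poly_Mapping.lookup"
  let ?P = "{tensor n c | c. \<forall>i\<in>{1..n}. c i \<in> simp_chains (Ks i)} :: ('v, 'k) tens set"
  have TP: "tensor_product n Ks = T.span ?P" by (simp add: tensor_product_def)
  have ch0: "0 \<in> simp_chains X" and chA: "x \<in> simp_chains X \<Longrightarrow> y \<in> simp_chains X \<Longrightarrow> x + y \<in> simp_chains X"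
    and chS: "x \<in> simp_chains X \<Longrightarrow> chain_scale a x \<in> simp_chains X"
    for X :: "'v set set" and x y and a :: 'k
    using keys_add[of x y] unfolding simp_chains_def
    by (simp, blast, metis (mono_tags) in_keys_iff lookup_chain_scale mem_Collect_eq mult_zero_right subset_iff)
  have ch1: "\<sigma> \<in> X \<Longrightarrow> Poly_Mapping.single \<sigma> (1::'k) \<in> simp_chains X" for X :: "'v set set" and \<sigma>
    by (auto simp: simp_chains_def)
  have slot: "m (c(i := (\<Sum>\<sigma>\<in>A. chain_scale (a \<sigma>) (Poly_Mapping.single \<sigma> 1)))) =
      (\<Sum>\<sigma>\<in>A. scl (a \<sigma>) (m (c(i := Poly_Mapping.single \<sigma> 1))))"
    if c: "\<And>j. j \<in> {1..n} \<Longrightarrow> c j \<in> simp_chains (Ks j)" and i: "i \<in> {1..n}"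
      and A: "finite A" "A \<subseteq> Ks i" for c i A a
    using A
  proof (induction A rule: finite_induct)
    case empty
    have "m (c(i := chain_scale 0 0)) = scl 0 (m (c(i := 0)))"
      by (rule scal[OF c i ch0])
    then show ?case by (simp only: sum.empty C.scale_zero_left W.scale_zero_left)
  next
    case (insert \<sigma> A)
    have "(\<Sum>\<tau>\<in>A. chain_scale (a \<tau>) (Poly_Mapping.single \<tau> (1::'k))) \<in> simp_chains (Ks i)"
      using insert.hyps(1) insert.prems
      by (induction A rule: finite_induct) (auto intro!: ch0 chA chS ch1)
    moreover have "\<sigma> \<in> Ks i" using insert.prems by simp
    ultimately show ?case
      using insert.prems
      by (simp only: sum.insert[OF insert.hyps] add[OF c i] scal[OF c i] chS ch1 insert.IH
          insert_subset)
  qed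
  have decomp: "x = (\<Sum>\<sigma>\<in>Poly_Mapping.keys x. chain_scale (?lk x \<sigma>) (Poly_Mapping.single \<sigma> 1))"
    for x :: "'v set \<Rightarrow>\<^sub>0 'k"
    by (rule poly_mapping_eqI)
      (auto simp: lookup_sum lookup_chain_scale lookup_single when_def sum.delta in_keys_iff
        if_distrib[of "(*) _"] cong: if_cong)
  have expand: "m c = (\<Sum>s\<in>(\<Pi>\<^sub>E i\<in>J. Poly_Mapping.keys (c i)).
      scl (\<Prod>i\<in>J. ?lk (c i) (s i)) (m (\<lambda>i. if i \<in> J then Poly_Mapping.single (s i) 1 else c i)))"
    if c: "\<And>j. j \<in> {1..n} \<Longrightarrow> c j \<in> simp_chains (Ks j)" and J: "finite J" "J \<subseteq> {1..n}" for c J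
    using J
  proof (induction J rule: finite_induct)
    case empty
    then show ?case by simp
  next
    case (insert j J)
    let ?k = "\<lambda>i. Poly_Mapping.keys (c i)"
    let ?c = "\<lambda>s i. if i \<in> J then Poly_Mapping.single (s i) 1 else c i"
    have j: "j \<in> {1..n}" "j \<notin> J" using insert by auto
    have step: "m (?c s) = (\<Sum>\<sigma>\<in>?k j. scl (?lk (c j) \<sigma>) (m ((?c s)(j := Poly_Mapping.single \<sigma> 1))))"
      if s: "s \<in> (\<Pi>\<^sub>E i\<in>J. ?k i)" for s
    proof -
      have s': "s i \<in> Ks i" if "i \<in> J" for i
        using s c[of i] that insert.prems by (force simp: simp_chains_def PiE_iff)
      have "m (?c s) = m ((?c s)(j := c j))"
        using j by (intro cong) auto
      also have "\<dots> = m ((?c s)(j := (\<Sum>\<sigma>\<in>?k j. chain_scale (?lk (c j) \<sigma>) (Poly_Mapping.single \<sigma> 1))))"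
        using decomp[of "c j"] by simp
      also have "\<dots> = (\<Sum>\<sigma>\<in>?k j. scl (?lk (c j) \<sigma>) (m ((?c s)(j := Poly_Mapping.single \<sigma> 1))))"
        by (rule slot) (use c j s' in \<open>auto intro: ch1 simp: simp_chains_def\<close>)
      finally show ?thesis .
    qed
    have "m c = (\<Sum>s\<in>(\<Pi>\<^sub>E i\<in>J. ?k i). scl (\<Prod>i\<in>J. ?lk (c i) (s i)) (m (?c s)))"
      using insert by simp
    also have "\<dots> = (\<Sum>s\<in>(\<Pi>\<^sub>E i\<in>J. ?k i). \<Sum>\<sigma>\<in>?k j.
        scl (?lk (c j) \<sigma> * (\<Prod>i\<in>J. ?lk (c i) (s i))) (m ((?c s)(j := Poly_Mapping.single \<sigma> 1))))"
      by (intro sum.cong refl) (simp add: step W.scale_sum_right mult.commute)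
    also have "\<dots> = (\<Sum>(\<sigma>, s)\<in>?k j \<times> (\<Pi>\<^sub>E i\<in>J. ?k i).
        scl (?lk (c j) \<sigma> * (\<Prod>i\<in>J. ?lk (c i) (s i))) (m ((?c s)(j := Poly_Mapping.single \<sigma> 1))))"
      by (subst sum.swap) (simp add: sum.cartesian_product)
    also have "\<dots> = (\<Sum>s\<in>(\<lambda>(\<sigma>, s). s(j := \<sigma>)) ` (?k j \<times> (\<Pi>\<^sub>E i\<in>J. ?k i)).
        scl (\<Prod>i\<in>insert j J. ?lk (c i) (s i))
          (m (\<lambda>i. if i \<in> insert j J then Poly_Mapping.single (s i) 1 else c i)))"
    proof (subst sum.reindex)
      show "inj_on (\<lambda>(\<sigma>, s). s(j := \<sigma>)) (?k j \<times> (\<Pi>\<^sub>E i\<in>J. ?k i))"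
        using inj_combinator[OF j(2)] by (simp add: case_prod_unfold)
      have e1: "(\<Prod>i\<in>insert j J. ?lk (c i) ((s(j := \<sigma>)) i)) =
          ?lk (c j) \<sigma> * (\<Prod>i\<in>J. ?lk (c i) (s i))" for s \<sigma>
      proof -
        have "(\<Prod>i\<in>J. ?lk (c i) ((s(j := \<sigma>)) i)) = (\<Prod>i\<in>J. ?lk (c i) (s i))"
          using j(2) by (intro prod.cong) auto
        then show ?thesis using insert.hyps by simp
      qed
      have e2: "(\<lambda>i. if i \<in> insert j J then Poly_Mapping.single ((s(j := \<sigma>)) i) 1 else c i) =
          (?c s)(j := Poly_Mapping.single \<sigma> 1)" for s \<sigma>
        using j(2) by auto
      show "(\<Sum>(\<sigma>, s)\<in>?k j \<times> (\<Pi>\<^sub>E i\<in>J. ?k i).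
          scl (?lk (c j) \<sigma> * (\<Prod>i\<in>J. ?lk (c i) (s i))) (m ((?c s)(j := Poly_Mapping.single \<sigma> 1)))) =
        sum ((\<lambda>s. scl (\<Prod>i\<in>insert j J. ?lk (c i) (s i))
          (m (\<lambda>i. if i \<in> insert j J then Poly_Mapping.single (s i) 1 else c i))) \<circ>
          (\<lambda>(\<sigma>, s). s(j := \<sigma>))) (?k j \<times> (\<Pi>\<^sub>E i\<in>J. ?k i))"
        by (intro sum.cong refl) (simp only: o_def case_prod_unfold e1 e2)
    qed
    also have "(\<lambda>(\<sigma>, s). s(j := \<sigma>)) ` (?k j \<times> (\<Pi>\<^sub>E i\<in>J. ?k i)) = (\<Pi>\<^sub>E i\<in>insert j J. ?k i)"
      by (simp add: PiE_insert_eq)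
    finally show ?case .
  qed
  define M where "M s = m (\<lambda>i. Poly_Mapping.single (s i) 1)" for s
  define L0 where "L0 t = (\<Sum>s\<in>Poly_Mapping.keys t. scl (?lk t s) (M s))" for t :: "('v, 'k) tens"
  have L0: "L0 t = (\<Sum>s\<in>A. scl (?lk t s) (M s))"
    if "finite A" "Poly_Mapping.keys t \<subseteq> A" for t A
    unfolding L0_def using that by (intro sum.mono_neutral_left) (auto simp: in_keys_iff)
  have L0_add: "L0 (t + u) = L0 t + L0 u" for t u
    using keys_add[of t u]
    by (simp add: L0[of "Poly_Mapping.keys t \<union> Poly_Mapping.keys u"] lookup_add
        W.scale_left_distrib sum.distrib)
  have L0_scale: "L0 (chain_scale a t) = scl a (L0 t)" for a t
    by (subst L0[of "Poly_Mapping.keys t"])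
      (auto simp: in_keys_iff lookup_chain_scale L0_def W.scale_sum_right)
  have L0_tensor: "L0 (tensor n c) = m c" if c: "\<And>j. j \<in> {1..n} \<Longrightarrow> c j \<in> simp_chains (Ks j)" for c
  proof -
    let ?A = "\<Pi>\<^sub>E i\<in>{1..n}. Poly_Mapping.keys (c i)"
    have keys: "Poly_Mapping.keys (tensor n c) \<subseteq> ?A"
    proof
      fix s assume "s \<in> Poly_Mapping.keys (tensor n c)"
      then have s: "s \<in> extensional {1..n}" and nz: "(\<Prod>i\<in>{1..n}. ?lk (c i) (s i)) \<noteq> 0"
        by (auto simp: in_keys_iff lookup_tensor split: if_splits)
      have "?lk (c i) (s i) \<noteq> 0" if "i \<in> {1..n}" for i
        using nz that by (metis prod_zero finite_atLeastAtMost)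
      with s show "s \<in> ?A" by (auto simp: PiE_iff in_keys_iff)
    qed
    have "L0 (tensor n c) = (\<Sum>s\<in>?A. scl (?lk (tensor n c) s) (M s))"
      by (rule L0[OF _ keys]) (intro finite_PiE, auto)
    also have "\<dots> = (\<Sum>s\<in>?A. scl (\<Prod>i\<in>{1..n}. ?lk (c i) (s i))
        (m (\<lambda>i. if i \<in> {1..n} then Poly_Mapping.single (s i) 1 else c i)))"
    proof (intro sum.cong refl)
      fix s assume "s \<in> ?A"
      moreover have "M s = m (\<lambda>i. if i \<in> {1..n} then Poly_Mapping.single (s i) 1 else c i)"
        unfolding M_def by (rule cong) auto
      ultimately show "scl (?lk (tensor n c) s) (M s) = scl (\<Prod>i\<in>{1..n}. ?lk (c i) (s i))
        (m (\<lambda>i. if i \<in> {1..n} then Poly_Mapping.single (s i) 1 else c i))"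
        by (simp add: lookup_tensor PiE_iff)
    qed
    also have "\<dots> = m c" by (rule expand[OF c, symmetric]) auto
    finally show ?thesis .
  qed
  let ?L = "\<lambda>t. if t \<in> tensor_product n Ks then L0 t else 0"
  show ?thesis
  proof (rule ex1I[of _ ?L])
    show "?L \<in> lin_hom (module_on (tensor_product n Ks) chain_scale) (module_on UNIV scl) \<and>
      (\<forall>t. t \<notin> tensor_product n Ks \<longrightarrow> ?L t = 0) \<and>
      (\<forall>c. (\<forall>i\<in>{1..n}. c i \<in> simp_chains (Ks i)) \<longrightarrow> ?L (tensor n c) = m c)"
      by (auto simp: lin_hom_def hom_def module_on_def TP T.span_add T.span_scale L0_add L0_scale
          simp del: One_nat_def intro!: T.span_base L0_tensor)
  next
    fix L
    assume L: "L \<in> lin_hom (module_on (tensor_product n Ks) chain_scale) (module_on UNIV scl) \<and>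
      (\<forall>t. t \<notin> tensor_product n Ks \<longrightarrow> L t = 0) \<and>
      (\<forall>c. (\<forall>i\<in>{1..n}. c i \<in> simp_chains (Ks i)) \<longrightarrow> L (tensor n c) = m c)"
    have La: "L (t + u) = L t + L u" if "t \<in> T.span ?P" "u \<in> T.span ?P" for t u
      using L that by (auto simp: lin_hom_def hom_def module_on_def TP)
    have Ls: "L (chain_scale a t) = scl a (L t)" if "t \<in> T.span ?P" for a t
      using L that by (auto simp: lin_hom_def module_on_def TP)
    have L0': "L 0 = 0" using Ls[of 0 0] by (simp add: T.span_zero)
    have "t \<in> T.span ?P \<and> L t = L0 t" if "t \<in> T.span ?P" for t
      using that
    proof (induction rule: T.span_induct_alt)
      case base
      show ?case using L0' by (simp add: L0_def T.span_zero)
    next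
      case (step a x y)
      have x: "x \<in> T.span ?P" using step by (auto intro: T.span_base)
      have "L x = L0 x" using step(1) L L0_tensor by auto
      then show ?case
        using step x by (simp add: La Ls T.span_add T.span_scale L0_add L0_scale)
    qed
    then show "L = ?L" using L TP by (auto simp: fun_eq_iff)
  qed
qed

definition simplex_tensor :: "nat \<Rightarrow> (nat \<Rightarrow> 'v set) \<Rightarrow> ('v, 'k::comm_ring_1) tens" where
  "simplex_tensor n s = tensor n (\<lambda>i. Poly_Mapping.single (s i) 1)"

definition tensor_product_deg ::
    "nat \<Rightarrow> (nat \<Rightarrow> 'v set set) \<Rightarrow> int \<Rightarrow> ('v, 'k::comm_ring_1) tens set" where
  "tensor_product_deg n Ks p = Modules.module.span chain_scale
     {tensor n c | c q. (\<Sum>i=1..n. q i) = p \<and> (\<forall>i\<in>{1..n}. c i \<in> simp_chains_deg (q i) (Ks i))}"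

definition tensor_diff ::
    "'v rel \<Rightarrow> nat \<Rightarrow> ('v, 'k) tens \<Rightarrow> ('v, 'k::comm_ring_1) tens" where
  "tensor_diff r n = lin_ext (\<lambda>s. \<Sum>i=1..n. chain_scale (pm_one (\<Sum>j=1..<i. sdim (s j)))
     (tensor n ((\<lambda>j. Poly_Mapping.single (s j) 1)(i := boundary r (s i)))))"


section \<open>Interaction homology and cohomology\<close>

definition disjoint_tuples :: "nat \<Rightarrow> (nat \<Rightarrow> 'v set set) \<Rightarrow> (nat \<Rightarrow> 'v set) set" where
  "disjoint_tuples n Ks = {s. (\<forall>i\<in>{1..n}. s i \<in> Ks i) \<and> (\<Inter>i\<in>{1..n}. s i) = {}}"

definition D_sub :: "nat \<Rightarrow> (nat \<Rightarrow> 'v set set) \<Rightarrow> ('v, 'k::comm_ring_1) tens set" where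
  "D_sub n Ks = Modules.module.span chain_scale (simplex_tensor n ` disjoint_tuples n Ks)"

definition tensor_module ::
    "nat \<Rightarrow> (nat \<Rightarrow> 'v set set) \<Rightarrow> int \<Rightarrow> ('k::comm_ring_1, ('v, 'k) tens) module" where
  "tensor_module n Ks p = module_on (tensor_product_deg n Ks p) chain_scale"

definition D_deg :: "nat \<Rightarrow> (nat \<Rightarrow> 'v set set) \<Rightarrow> int \<Rightarrow> ('v, 'k::comm_ring_1) tens set" where
  "D_deg n Ks p = D_sub n Ks \<inter> tensor_product_deg n Ks p"

definition IC ::
    "nat \<Rightarrow> (nat \<Rightarrow> 'v set set) \<Rightarrow> int \<Rightarrow> ('k::comm_ring_1, ('v, 'k) tens set) module" where
  "IC n Ks p = quotient_module (tensor_module n Ks p) (D_deg n Ks p)"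

definition IC_diff ::
    "'v rel \<Rightarrow> nat \<Rightarrow> (nat \<Rightarrow> 'v set set) \<Rightarrow> int \<Rightarrow>
     ('v, 'k::comm_ring_1) tens set \<Rightarrow> ('v, 'k) tens set" where
  "IC_diff r n Ks p X =
    (\<Union>t\<in>X. D_deg n Ks (p - 1) +>\<^bsub>tensor_module n Ks (p - 1)\<^esub> tensor_diff r n t)"

definition interaction_homology ::
    "'v rel \<Rightarrow> nat \<Rightarrow> (nat \<Rightarrow> 'v set set) \<Rightarrow> int \<Rightarrow>
     ('k::comm_ring_1, ('v, 'k) tens set set) module" where
  "interaction_homology r n Ks = homology (IC n Ks) (IC_diff r n Ks) (-1)"

definition interaction_cochains ::
    "nat \<Rightarrow> (nat \<Rightarrow> 'v set set) \<Rightarrow> (('v, 'k::comm_ring_1) tens \<Rightarrow> 'k) set" where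
  "interaction_cochains n Ks =
    {f \<in> carrier (dual_module (module_on (tensor_product n Ks) chain_scale)).
      \<forall>s\<in>disjoint_tuples n Ks. f (simplex_tensor n s) = 0}"

text \<open>
  A map defined on \<open>C\<^bsub>p\<^sub>1\<^esub>(K\<^sub>1) \<otimes> \<dots> \<otimes> C\<^bsub>p\<^sub>n\<^esub>(K\<^sub>n)\<close> only is extended by \<open>0\<close> to the other summands.
\<close>

definition interaction_pcochains ::
    "nat \<Rightarrow> (nat \<Rightarrow> 'v set set) \<Rightarrow> int \<Rightarrow> (('v, 'k::comm_ring_1) tens \<Rightarrow> 'k) set" where
  "interaction_pcochains n Ks p =
    {f \<in> interaction_cochains n Ks. \<exists>q. (\<Sum>i=1..n. q i) = p \<and>
      (\<forall>s. (\<forall>i\<in>{1..n}. s i \<in> Ks i) \<and> (\<exists>i\<in>{1..n}. sdim (s i) \<noteq> q i) \<longrightarrow>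
        f (simplex_tensor n s) = 0)}"

definition IC_co ::
    "nat \<Rightarrow> (nat \<Rightarrow> 'v set set) \<Rightarrow> int \<Rightarrow> ('k::comm_ring_1, ('v, 'k) tens \<Rightarrow> 'k) module" where
  "IC_co n Ks p = module_on (Modules.module.span fun_scale (interaction_pcochains n Ks p)) fun_scale"

definition IC_codiff ::
    "'v rel \<Rightarrow> nat \<Rightarrow> (nat \<Rightarrow> 'v set set) \<Rightarrow> int \<Rightarrow>
     (('v, 'k::comm_ring_1) tens \<Rightarrow> 'k) \<Rightarrow> ('v, 'k) tens \<Rightarrow> 'k" where
  "IC_codiff r n Ks p f =
    (\<lambda>t. if t \<in> tensor_product n Ks then - (pm_one p * f (tensor_diff r n t)) else 0)"

definition interaction_cohomology ::
    "'v rel \<Rightarrow> nat \<Rightarrow> (nat \<Rightarrow> 'v set set) \<Rightarrow> int \<Rightarrow>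
     ('k::comm_ring_1, (('v, 'k) tens \<Rightarrow> 'k) set) module" where
  "interaction_cohomology r n Ks = homology (IC_co n Ks) (IC_codiff r n Ks) 1"

text \<open>
  The value of \<open>\<psi> [f]\<close> at \<open>[z]\<close> is the common value of \<open>f t\<close> for all cocycles \<open>f\<close> in the class
  \<open>F\<close>, all cycles \<open>z\<close> in the class \<open>Z\<close>, and all lifts \<open>t\<close> of \<open>z\<close> to the tensor product.
\<close>

definition psi ::
    "'v rel \<Rightarrow> nat \<Rightarrow> (nat \<Rightarrow> 'v set set) \<Rightarrow> int \<Rightarrow>
     (('v, 'k::comm_ring_1) tens \<Rightarrow> 'k) set \<Rightarrow> ('v, 'k) tens set set \<Rightarrow> 'k" where
  "psi r n Ks p F = (\<lambda>Z.
     if Z \<in> carrier (interaction_homology r n Ks p)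
     then THE a. \<exists>f\<in>F. \<exists>z\<in>Z. \<exists>t\<in>z. a = f t
     else 0)"

definition cocycle_class ::
    "'v rel \<Rightarrow> nat \<Rightarrow> (nat \<Rightarrow> 'v set set) \<Rightarrow> int \<Rightarrow>
     (('v, 'k::comm_ring_1) tens \<Rightarrow> 'k) \<Rightarrow> (('v, 'k) tens \<Rightarrow> 'k) set" where
  "cocycle_class r n Ks p f =
    boundaries (IC_co n Ks) (IC_codiff r n Ks) 1 p +>\<^bsub>IC_co n Ks p\<^esub> f"

definition cycle_class ::
    "'v rel \<Rightarrow> nat \<Rightarrow> (nat \<Rightarrow> 'v set set) \<Rightarrow> int \<Rightarrow>
     ('v, 'k::comm_ring_1) tens set \<Rightarrow> ('v, 'k) tens set set" where
  "cycle_class r n Ks p z =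
    boundaries (IC n Ks) (IC_diff r n Ks) (-1) p +>\<^bsub>IC n Ks p\<^esub> z"

end

theory Submission
  imports Defs
begin

text \<open>
  The complex \<open>D\<^sub>*\<close> is spanned by a subset of the basis of simplex tensors, so an interaction
  \<open>p\<close>-cochain is a functional on the tensor product that is supported on the basis elements of
  degree \<open>p\<close> outside \<open>D\<^sub>*\<close>, and the homology of the quotient is the quotient of the relative
  cycles \<open>{t \<in> T\<^sub>p. d t \<in> D\<^bsub>p-1\<^esub>}\<close> by the relative boundaries \<open>d T\<^bsub>p+1\<^esub> + D\<^sub>p\<close>.  Both injectivity
  and surjectivity of \<open>\<psi>\<close> then follow from one extension property over a field: a functional on
  a subspace \<open>A\<close> that vanishes wherever \<open>d\<close> takes values in \<open>D\<close> factors as \<open>g \<circ> d\<close>, with \<open>g\<close>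
  defined everywhere and zero on \<open>D\<close>.  For injectivity \<open>d\<close> is the differential and \<open>A = T\<^sub>p\<close>; for
  surjectivity \<open>d\<close> is the identity, \<open>A\<close> consists of the relative cycles and \<open>D\<close> of the relative
  boundaries.
\<close>

section \<open>Extension of linear maps from subspaces\<close>

text \<open>Only the values of \<open>f\<close> on \<open>A\<close> matter. A basis of
  \<open>A\<close> is independent in the whole space, so a linear \<open>g\<close> can be prescribed
  on it, and linearity of \<open>f\<close> on \<open>A\<close> spreads the agreement from the basis
  to \<open>A\<close>.\<close>

lemma (in vector_space_pair) linear_extend_subspace:
  assumes "vs1.subspace A"
    and add: "\<And>x y. x \<in> A \<Longrightarrow> y \<in> A \<Longrightarrow> f (x + y) = f x + f y"
    and scale: "\<And>a x. x \<in> A \<Longrightarrow> f (s1 a x) = s2 a (f x)"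
  obtains g where "Vector_Spaces.linear s1 s2 g" "\<And>x. x \<in> A \<Longrightarrow> g x = f x"
proof -
  obtain B where B: "B \<subseteq> A" "vs1.independent B" "A \<subseteq> vs1.span B"
    using vs1.basis_exists[of A] by metis
  obtain g where g: "Vector_Spaces.linear s1 s2 g" "\<forall>x\<in>B. g x = f x"
    using linear_independent_extend[OF B(2)] by blast
  interpret g: Vector_Spaces.linear s1 s2 g by (rule g(1))
  have f0: "f 0 = 0"
    using scale[of 0 0] vs1.subspace_0[OF assms(1)] by simp
  \<comment> \<open>Membership in \<open>A\<close> is carried through the induction because
    \<open>f\<close> is assumed additive and homogeneous only there.\<close>
  have "x \<in> A \<and> g x = f x" if "x \<in> vs1.span B" for x
    using that
  proof (induction rule: vs1.span_induct_alt)
    case base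
    then show ?case using f0 vs1.subspace_0[OF assms(1)] by (simp add: g.zero)
  next
    case (step c x y)
    then show ?case
      using B(1) g(2) assms(1)
      by (auto simp: add scale g.add g.scale vs1.subspace_add vs1.subspace_scale)
  qed
  then show ?thesis using that[OF g(1)] B(3) by blast
qed

text \<open>On the sum of \<open>D\<close> and the image of \<open>A\<close> under \<open>d\<close>,
  send \<open>d x + y\<close> to \<open>f x\<close>. Two choices of \<open>x\<close> differ by an
  element of \<open>A\<close> that \<open>d\<close> maps into \<open>D\<close>, so
  \<open>ker\<close> makes this well defined. It is linear on that subspace and extends to the whole
  space.\<close>

lemma (in vector_space_pair) linear_factor:
  assumes lin: "Vector_Spaces.linear s s1 d" and A: "Modules.module.subspace s A"
    and D: "vs1.subspace D"
    and add: "\<And>x y. x \<in> A \<Longrightarrow> y \<in> A \<Longrightarrow> f (x + y) = f x + f y"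
    and scale: "\<And>a x. x \<in> A \<Longrightarrow> f (s a x) = s2 a (f x)"
    and ker: "\<And>x. x \<in> A \<Longrightarrow> d x \<in> D \<Longrightarrow> f x = 0"
  obtains g where "Vector_Spaces.linear s1 s2 g"
    "\<And>x. x \<in> A \<Longrightarrow> g (d x) = f x" "\<And>y. y \<in> D \<Longrightarrow> g y = 0"
proof -
  interpret d: Vector_Spaces.linear s s1 d by (rule lin)
  note sub = d.vs1.subspace_add[OF A] d.vs1.subspace_scale[OF A] d.vs1.subspace_0[OF A]
    d.vs1.subspace_diff[OF A]
  let ?E = "{d x + y |x y. x \<in> A \<and> y \<in> D}"
  \<comment> \<open>Some preimage of \<open>w\<close> modulo \<open>D\<close> is chosen; the next
    fact shows that the choice does not influence the value.\<close>
  define h where "h w = f (SOME x. x \<in> A \<and> w - d x \<in> D)" for w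
  have h: "h (d x + y) = f x" if x: "x \<in> A" and y: "y \<in> D" for x y
  proof -
    let ?x = "SOME x'. x' \<in> A \<and> d x + y - d x' \<in> D"
    have *: "?x \<in> A \<and> d x + y - d ?x \<in> D"
      by (rule someI[of _ x]) (use x y in simp)
    have "d (?x - x) = y - (d x + y - d ?x)" by (simp add: d.diff)
    then have "d (?x - x) \<in> D" using vs1.subspace_diff[OF D y conjunct2[OF *]] by simp
    moreover have diff: "?x - x \<in> A" using * x sub(4) by blast
    ultimately have "f (?x - x) = 0" using ker by blast
    then have "f ?x = f x" using add[OF diff x] by simp
    then show ?thesis by (simp add: h_def)
  qed
  have "?E = {x + y |x y. x \<in> d ` A \<and> y \<in> D}" by blast
  then have E: "vs1.subspace ?E"
    using vs1.subspace_sums[OF d.subspace_image[OF A] D] by simp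
  obtain g where g: "Vector_Spaces.linear s1 s2 g" "\<And>w. w \<in> ?E \<Longrightarrow> g w = h w"
  proof (rule linear_extend_subspace[OF E, of h])
    fix w w' assume "w \<in> ?E" "w' \<in> ?E"
    then obtain x y x' y' where w: "w = d x + y" "w' = d x' + y'"
      and in_A: "x \<in> A" "y \<in> D" "x' \<in> A" "y' \<in> D" by auto
    have "w + w' = d (x + x') + (y + y')" by (simp add: w d.add algebra_simps)
    then show "h (w + w') = h w + h w'"
      using in_A h sub add vs1.subspace_add[OF D] w by metis
  next
    fix a w assume "w \<in> ?E"
    then obtain x y where w: "w = d x + y" and in_A: "x \<in> A" "y \<in> D" by auto
    have "s1 a w = d (s a x) + s1 a y" by (simp add: w d.scale vs1.scale_right_distrib)
    then show "h (s1 a w) = s2 a (h w)"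
      using in_A h sub scale vs1.subspace_scale[OF D] w by metis
  qed blast
  have "g (d x + y) = f x" if "x \<in> A" "y \<in> D" for x y
  proof -
    have "d x + y \<in> ?E" using that by blast
    then show ?thesis using g(2) h[OF that] by simp
  qed
  \<comment> \<open>Taking \<open>y = 0\<close> gives the factorization. Taking \<open>x = 0\<close>
    gives \<open>g y = f 0\<close>, and \<open>f 0 = 0\<close> by \<open>ker\<close>, since
    \<open>d 0 = 0\<close> lies in \<open>D\<close>.\<close>
  from this[of _ 0] this[of 0] show ?thesis
    using that[OF g(1)] vs1.subspace_0[OF D] sub ker[of 0] by (simp add: d.zero)
qed

section \<open>The tensor product on its basis\<close>

lemma vector_space_chain_scale: "vector_space (chain_scale :: 'k::field \<Rightarrow> ('a \<Rightarrow>\<^sub>0 'k) \<Rightarrow> _)"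
  by unfold_locales
    (auto intro!: poly_mapping_eqI simp: lookup_chain_scale lookup_add algebra_simps)

lemma vector_space_fun_scale: "vector_space (fun_scale :: 'k::field \<Rightarrow> ('m \<Rightarrow> 'k) \<Rightarrow> _)"
  by unfold_locales (auto simp: fun_scale_def fun_eq_iff algebra_simps)

interpretation chain: vector_space "chain_scale :: 'k::field \<Rightarrow> ('a \<Rightarrow>\<^sub>0 'k) \<Rightarrow> _"
  by (rule vector_space_chain_scale)

interpretation functional: vector_space "fun_scale :: 'k::field \<Rightarrow> ('m \<Rightarrow> 'k) \<Rightarrow> _"
  by (rule vector_space_fun_scale)

text \<open>These are the coordinate subspaces. The tensor product, its graded pieces and
  \<open>D\<close> all turn out to be of this form, so that inclusions and intersections become
  statements about sets of tuples.\<close>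

definition supported :: "'a set \<Rightarrow> ('a \<Rightarrow>\<^sub>0 'k::zero) set" where
  "supported S = {t. Poly_Mapping.keys t \<subseteq> S}"

lemma subspace_supported: "chain.subspace (supported S :: ('a \<Rightarrow>\<^sub>0 'k::field) set)"
proof (rule chain.subspaceI)
  show "x + y \<in> supported S" if "x \<in> supported S" "y \<in> supported S" for x y :: "'a \<Rightarrow>\<^sub>0 'k"
    using that keys_add[of x y] by (auto simp: supported_def)
qed (auto simp: supported_def in_keys_iff lookup_chain_scale subset_iff)

lemma supported_mono: "S \<subseteq> S' \<Longrightarrow> supported S \<subseteq> supported S'"
  by (auto simp: supported_def)

lemma supported_Int: "supported (S \<inter> S') = supported S \<inter> supported S'"
  by (auto simp: supported_def)

lemma single_in_supported [simp]: "s \<in> S \<Longrightarrow> Poly_Mapping.single s a \<in> supported S"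
  by (auto simp: supported_def)

lemma chain_decomp:
  "t = (\<Sum>s\<in>Poly_Mapping.keys t. chain_scale (Poly_Mapping.lookup t s) (Poly_Mapping.single s (1::'k::field)))"
  by (rule poly_mapping_eqI)
    (auto simp: lookup_sum lookup_chain_scale lookup_single when_def sum.delta in_keys_iff
      if_distrib[of "(*) _"] cong: if_cong)

text \<open>The generators need not be basis elements: it suffices that the required basis elements
  occur among them and that none leaves the coordinate subspace. This covers spans of arbitrary pure
  tensors.\<close>

lemma span_eq_supported:
  fixes G :: "('a \<Rightarrow>\<^sub>0 'k::field) set"
  assumes "\<And>s. s \<in> S \<Longrightarrow> Poly_Mapping.single s 1 \<in> G" "G \<subseteq> supported S"
  shows "chain.span G = supported S"
proof
  show "chain.span G \<subseteq> supported S"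
    by (rule chain.span_minimal[OF assms(2) subspace_supported])
  show "supported S \<subseteq> chain.span G"
  proof
    fix t :: "'a \<Rightarrow>\<^sub>0 'k" assume "t \<in> supported S"
    then show "t \<in> chain.span G"
      by (subst chain_decomp, intro chain.span_sum chain.span_scale chain.span_base assms(1))
        (auto simp: supported_def)
  qed
qed

section \<open>The modules of the construction as coordinate subspaces\<close>

definition tuples_deg :: "nat \<Rightarrow> (nat \<Rightarrow> 'v set set) \<Rightarrow> int \<Rightarrow> (nat \<Rightarrow> 'v set) set" where
  "tuples_deg n Ks p = {s \<in> \<Pi>\<^sub>E i\<in>{1..n}. Ks i. (\<Sum>i=1..n. sdim (s i)) = p}"

text \<open>No condition on membership in the complexes is included, so that \<open>D\<close> and
  its graded pieces arise by intersecting this one set with the relevant set of tuples.\<close>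

definition empty_tuples :: "nat \<Rightarrow> (nat \<Rightarrow> 'v set) set" where
  "empty_tuples n = {s. (\<Inter>i\<in>{1..n}. s i) = {}}"

text \<open>The coefficient at an extensional \<open>t\<close> is a product of Kronecker deltas,
  which vanishes as soon as one slot differs. Values of \<open>s\<close> outside
  \<open>{1..n}\<close> do not enter, hence \<open>restrict\<close>.\<close>

lemma simplex_tensor_eq:
  "simplex_tensor n s = Poly_Mapping.single (restrict s {1..n}) (1::'k::field)"
proof (rule poly_mapping_eqI)
  fix t
  show "Poly_Mapping.lookup (simplex_tensor n s) t =
    Poly_Mapping.lookup (Poly_Mapping.single (restrict s {1..n}) (1::'k)) t"
  proof (cases "t = restrict s {1..n}")
    case True
    then show ?thesis by (simp add: simplex_tensor_def lookup_tensor lookup_single)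
  next
    case False
    then have "\<exists>i\<in>{1..n}. s i \<noteq> t i" if "t \<in> extensional {1..n}"
      using that by (metis (no_types, lifting) extensionalityI restrict_apply restrict_extensional)
    then have "(\<Prod>i\<in>{1..n}. 1 when s i = t i) = (0::'k)" if "t \<in> extensional {1..n}"
      using that by (auto simp: when_def intro!: prod_zero)
    then show ?thesis using False
      by (auto simp add: simplex_tensor_def lookup_tensor lookup_single)
  qed
qed

lemma keys_tensor:
  "Poly_Mapping.keys (tensor n c :: ('v, 'k::field) tens) \<subseteq> (\<Pi>\<^sub>E i\<in>{1..n}. Poly_Mapping.keys (c i))"
proof
  fix s assume "s \<in> Poly_Mapping.keys (tensor n c)"
  then have "s \<in> extensional {1..n}" "(\<Prod>i\<in>{1..n}. Poly_Mapping.lookup (c i) (s i)) \<noteq> 0"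
    by (simp_all add: in_keys_iff lookup_tensor split: if_splits)
  then show "s \<in> (\<Pi>\<^sub>E i\<in>{1..n}. Poly_Mapping.keys (c i))"
    by (simp add: PiE_iff in_keys_iff)
qed

lemma tensor_in_supported:
  "(\<And>s. s \<in> (\<Pi>\<^sub>E i\<in>{1..n}. Poly_Mapping.keys (c i)) \<Longrightarrow> s \<in> S) \<Longrightarrow> (tensor n c :: ('v, 'k::field) tens) \<in> supported S"
  using keys_tensor[of n c] by (auto simp: supported_def)

lemma tensor_product_eq:
  "(tensor_product n Ks :: ('v, 'k::field) tens set) = supported (\<Pi>\<^sub>E i\<in>{1..n}. Ks i)"
  unfolding tensor_product_def
proof (rule span_eq_supported)
  fix s assume s: "s \<in> (\<Pi>\<^sub>E i\<in>{1..n}. Ks i)"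
  then have "Poly_Mapping.single s (1::'k) = simplex_tensor n s"
    by (simp add: simplex_tensor_eq)
  then show "Poly_Mapping.single s (1::'k) \<in> {tensor n c |c. \<forall>i\<in>{1..n}. c i \<in> simp_chains (Ks i)}"
    using s by (auto simp: simplex_tensor_def simp_chains_def intro!: exI[of _ "\<lambda>i. Poly_Mapping.single (s i) 1"])
qed (auto simp: simp_chains_def PiE_iff intro!: tensor_in_supported simp del: One_nat_def)

lemma tensor_product_deg_eq:
  "(tensor_product_deg n Ks p :: ('v, 'k::field) tens set) = supported (tuples_deg n Ks p)"
  unfolding tensor_product_deg_def
proof (rule span_eq_supported)
  fix s assume s: "s \<in> tuples_deg n Ks p"
  then have "Poly_Mapping.single s (1::'k) = simplex_tensor n s"
    unfolding tuples_deg_def simplex_tensor_eq using PiE_restrict by fastforce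
  then show "Poly_Mapping.single s (1::'k) \<in> {tensor n c |c q. (\<Sum>i=1..n. q i) = p \<and>
      (\<forall>i\<in>{1..n}. c i \<in> simp_chains_deg (q i) (Ks i))}"
    using s by (auto simp: simplex_tensor_def simp_chains_deg_def simp_chains_def tuples_deg_def
      intro!: exI[of _ "\<lambda>i. Poly_Mapping.single (s i) 1"] exI[of _ "\<lambda>i. sdim (s i)"])
next
  show "{tensor n c |c q. (\<Sum>i=1..n. q i) = p \<and> (\<forall>i\<in>{1..n}. c i \<in> simp_chains_deg (q i) (Ks i))}
      \<subseteq> (supported (tuples_deg n Ks p) :: ('v, 'k) tens set)"
  proof clarify
    fix c :: "nat \<Rightarrow> ('v set \<Rightarrow>\<^sub>0 'k)" and q
    assume c: "\<forall>i\<in>{1..n}. c i \<in> simp_chains_deg (q i) (Ks i)" and p: "p = (\<Sum>i=1..n. q i)"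
    show "tensor n c \<in> supported (tuples_deg n Ks (\<Sum>i=1..n. q i))"
    proof (rule tensor_in_supported)
      fix s assume "s \<in> (\<Pi>\<^sub>E i\<in>{1..n}. Poly_Mapping.keys (c i))"
      then have "s \<in> extensional {1..n}" "\<And>i. i \<in> {1..n} \<Longrightarrow> s i \<in> Ks i \<and> sdim (s i) = q i"
        using c unfolding PiE_iff simp_chains_deg_def simp_chains_def by blast+
      then show "s \<in> tuples_deg n Ks (\<Sum>i=1..n. q i)"
        unfolding tuples_deg_def PiE_iff by (auto intro!: sum.cong)
    qed
  qed
qed

lemma D_sub_eq:
  "(D_sub n Ks :: ('v, 'k::field) tens set) = supported ((\<Pi>\<^sub>E i\<in>{1..n}. Ks i) \<inter> empty_tuples n)"
  unfolding D_sub_def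
proof (rule span_eq_supported)
  fix s assume s: "s \<in> (\<Pi>\<^sub>E i\<in>{1..n}. Ks i) \<inter> empty_tuples n"
  then have "Poly_Mapping.single s (1::'k) = simplex_tensor n s"
    unfolding simplex_tensor_eq using PiE_restrict by fastforce
  moreover have "s \<in> disjoint_tuples n Ks"
    using s by (auto simp: disjoint_tuples_def empty_tuples_def simp del: One_nat_def)
  ultimately show "Poly_Mapping.single s (1::'k) \<in> simplex_tensor n ` disjoint_tuples n Ks"
    by auto
qed (auto simp: simplex_tensor_eq disjoint_tuples_def empty_tuples_def simp del: One_nat_def)

lemma D_deg_eq:
  "(D_deg n Ks p :: ('v, 'k::field) tens set) = supported (tuples_deg n Ks p \<inter> empty_tuples n)"
  unfolding D_deg_def D_sub_eq tensor_product_deg_eq supported_Int[symmetric]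
  by (rule arg_cong[of _ _ supported]) (auto simp: tuples_deg_def)

text \<open>Coefficients outside the support are zero, so the index set may be enlarged. This lets
  two chains and their sum be expanded over one common set.\<close>

lemma lin_ext_eq:
  assumes "finite A" "Poly_Mapping.keys c \<subseteq> A"
  shows "lin_ext \<phi> c = (\<Sum>x\<in>A. chain_scale (Poly_Mapping.lookup c x) (\<phi> x :: 'b \<Rightarrow>\<^sub>0 'k::field))"
  unfolding lin_ext_def using assms
  by (intro sum.mono_neutral_left) (auto simp: in_keys_iff)

lemma linear_lin_ext:
  "Vector_Spaces.linear chain_scale chain_scale (lin_ext (\<phi> :: 'a \<Rightarrow> ('b \<Rightarrow>\<^sub>0 'k::field)))"
proof (unfold_locales)
  fix b c :: "'a \<Rightarrow>\<^sub>0 'k"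
  show "lin_ext \<phi> (b + c) = lin_ext \<phi> b + lin_ext \<phi> c"
    using keys_add[of b c]
    by (simp add: lin_ext_eq[of "Poly_Mapping.keys b \<union> Poly_Mapping.keys c"] lookup_add
        chain.scale_left_distrib sum.distrib)
next
  fix a :: 'k and c :: "'a \<Rightarrow>\<^sub>0 'k"
  show "lin_ext \<phi> (chain_scale a c) = chain_scale a (lin_ext \<phi> c)"
    by (subst lin_ext_eq[of "Poly_Mapping.keys c"])
      (auto simp: in_keys_iff lookup_chain_scale lin_ext_def chain.scale_sum_right)
qed

section \<open>The differential squares to zero\<close>

lemma tensor_sum:
  fixes c :: "nat \<Rightarrow> ('v set \<Rightarrow>\<^sub>0 'k::field)"
  assumes "i \<in> {1..n}"
  shows "tensor n (c(i := \<Sum>v\<in>A. chain_scale (a v) (x v))) =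
    (\<Sum>v\<in>A. chain_scale (a v) (tensor n (c(i := x v))))"
proof -
  \<comment> \<open>Needed for the empty sum, and also for an infinite \<open>A\<close>, where both
    sums take the default value 0.\<close>
  have zero: "tensor n (c(i := 0)) = 0"
    using tensor_scale[OF assms, of c 0 0] by simp
  show ?thesis
  proof (induction A rule: infinite_finite_induct)
    case (insert v A)
    then show ?case
      by (simp only: sum.insert[OF insert.hyps] tensor_add[OF assms] tensor_scale[OF assms])
  qed (simp_all add: zero del: fun_upd_apply)
qed

section \<open>Deletions of vertices and their signs\<close>

definition faces :: "nat \<Rightarrow> (nat \<Rightarrow> 'v set) \<Rightarrow> (nat \<times> 'v) set" where
  "faces n s = (SIGMA i:{1..n}. {v. v \<in> s i \<and> s i - {v} \<noteq> {}})"

definition delete_vertex :: "(nat \<Rightarrow> 'v set) \<Rightarrow> nat \<times> 'v \<Rightarrow> nat \<Rightarrow> 'v set" where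
  "delete_vertex s x = s(fst x := s (fst x) - {snd x})"

text \<open>The first factor is the Koszul sign from moving the differential past the earlier slots,
  the second is the sign of the face in the simplicial boundary.\<close>

definition face_sign :: "'v rel \<Rightarrow> (nat \<Rightarrow> 'v set) \<Rightarrow> nat \<times> 'v \<Rightarrow> 'k::comm_ring_1" where
  "face_sign r s x = pm_one (\<Sum>j=1..<fst x. sdim (s j)) *
     pm_one (int (card {u \<in> s (fst x). u \<noteq> snd x \<and> (u, snd x) \<in> r}))"

definition finite_tuples :: "nat \<Rightarrow> (nat \<Rightarrow> 'v set) set" where
  "finite_tuples n = (\<Pi>\<^sub>E i\<in>{1..n}. {\<sigma>. finite \<sigma>})"

lemma finite_faces: "s \<in> finite_tuples n \<Longrightarrow> finite (faces n s)"
  unfolding faces_def finite_tuples_def by (intro finite_SigmaI) (auto dest: PiE_mem)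

lemma delete_vertex_finite_tuples:
  "s \<in> finite_tuples n \<Longrightarrow> x \<in> faces n s \<Longrightarrow> delete_vertex s x \<in> finite_tuples n"
  by (auto simp: finite_tuples_def delete_vertex_def faces_def PiE_iff extensional_def)

text \<open>Multilinearity pulls the boundary sum out of slot \<open>i\<close>; merging it with the
  sum over slots leaves one sum indexed by pairs of a slot and a vertex. In this form the square of
  the differential is a sum over pairs of deletions.\<close>

lemma tensor_diff_single:
  assumes s: "s \<in> finite_tuples n"
  shows "tensor_diff r n (Poly_Mapping.single s (1::'k::field)) =
    (\<Sum>x\<in>faces n s. chain_scale (face_sign r s x) (Poly_Mapping.single (delete_vertex s x) 1))"
proof -
  let ?e = "\<lambda>j. Poly_Mapping.single (s j) (1::'k)"
  let ?A = "\<lambda>i. {v. v \<in> s i \<and> s i - {v} \<noteq> {}}"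
  let ?b = "\<lambda>i v. pm_one (int (card {u \<in> s i. u \<noteq> v \<and> (u, v) \<in> r})) :: 'k"
  let ?a = "\<lambda>i. pm_one (\<Sum>j=1..<i. sdim (s j)) :: 'k"
  have slot: "tensor n (?e(i := boundary r (s i))) =
      (\<Sum>v\<in>?A i. chain_scale (?b i v) (Poly_Mapping.single (delete_vertex s (i, v)) 1))"
    if i: "i \<in> {1..n}" for i
  proof -
    have "boundary r (s i) =
        (\<Sum>v\<in>?A i. chain_scale (?b i v) (Poly_Mapping.single (s i - {v}) (1::'k)))"
      unfolding boundary_def
      by (intro sum.cong refl poly_mapping_eqI)
        (simp add: lookup_chain_scale lookup_single when_def)
    moreover have "tensor n (?e(i := Poly_Mapping.single (s i - {v}) 1)) =
        Poly_Mapping.single (delete_vertex s (i, v)) (1::'k)" for v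
    proof -
      have "tensor n (?e(i := Poly_Mapping.single (s i - {v}) 1)) =
          simplex_tensor n (delete_vertex s (i, v))"
        unfolding simplex_tensor_def by (rule tensor_cong) (simp add: delete_vertex_def)
      moreover have "restrict (delete_vertex s (i, v)) {1..n} = delete_vertex s (i, v)"
        using i s by (intro extensional_restrict)
          (auto simp: delete_vertex_def finite_tuples_def PiE_iff extensional_def)
      ultimately show ?thesis by (simp only: simplex_tensor_eq)
    qed
    ultimately show ?thesis by (simp only: tensor_sum[OF i])
  qed
  have "tensor_diff r n (Poly_Mapping.single s 1) =
      (\<Sum>i=1..n. chain_scale (?a i) (tensor n (?e(i := boundary r (s i)))))"
    by (simp add: tensor_diff_def lin_ext_def)
  also have "\<dots> = (\<Sum>i=1..n. \<Sum>v\<in>?A i. chain_scale (face_sign r s (i, v))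
      (Poly_Mapping.single (delete_vertex s (i, v)) 1))"
    by (intro sum.cong refl)
      (simp add: slot chain.scale_sum_right face_sign_def del: One_nat_def)
  also have "\<dots> = (\<Sum>x\<in>faces n s. chain_scale (face_sign r s x) (Poly_Mapping.single (delete_vertex s x) 1))"
    using s unfolding faces_def
    by (subst sum.Sigma) (auto simp: finite_tuples_def dest!: PiE_mem)
  finally show ?thesis .
qed

interpretation tensor_diff: Vector_Spaces.linear chain_scale chain_scale
  "tensor_diff r n :: ('v, 'k::field) tens \<Rightarrow> _"
  unfolding tensor_diff_def by (rule linear_lin_ext)

text \<open>Reduces the behaviour of the differential on a coordinate subspace to closure of its
  index set under deleting vertices. It serves the graded pieces, the whole tensor product and
  \<open>D\<close> alike.\<close>

lemma tensor_diff_supported: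
  fixes t :: "('v, 'k::field) tens"
  assumes t: "t \<in> supported S" and fin: "S \<subseteq> finite_tuples n"
    and face: "\<And>s x. s \<in> S \<Longrightarrow> x \<in> faces n s \<Longrightarrow> delete_vertex s x \<in> S'"
  shows "tensor_diff r n t \<in> supported S'"
proof -
  note subs = chain.subspace_sum[OF subspace_supported] chain.subspace_scale[OF subspace_supported]
  have single: "tensor_diff r n (Poly_Mapping.single s (1::'k)) \<in> supported S'" if "s \<in> S" for s
    using that fin face by (subst tensor_diff_single) (auto intro!: subs)
  have "tensor_diff r n t = (\<Sum>s\<in>Poly_Mapping.keys t. chain_scale (Poly_Mapping.lookup t s)
      (tensor_diff r n (Poly_Mapping.single s 1)))"
    by (subst chain_decomp) (simp only: tensor_diff.sum tensor_diff.scale)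
  also have "\<dots> \<in> supported S'"
    using t single by (intro subs) (auto simp: supported_def)
  finally show ?thesis .
qed

lemma pm_one_diff_1: "pm_one (m - 1) = - pm_one m"
  by (simp add: pm_one_def)

lemma sdim_delete: "finite \<sigma> \<Longrightarrow> v \<in> \<sigma> \<Longrightarrow> sdim (\<sigma> - {v}) = sdim \<sigma> - 1"
  using card_gt_0_iff[of \<sigma>] by (auto simp: sdim_def card_Diff_singleton of_nat_diff)

text \<open>The strict lexicographic order on deletions, by slot and then by vertex. Since
  \<open>r\<close> will be reflexive, equal vertices have to be excluded explicitly.\<close>

definition face_less :: "'v rel \<Rightarrow> nat \<times> 'v \<Rightarrow> nat \<times> 'v \<Rightarrow> bool" where
  "face_less r x y \<longleftrightarrow> fst x < fst y \<or> fst x = fst y \<and> snd x \<noteq> snd y \<and> (snd x, snd y) \<in> r"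

text \<open>Deleting a vertex lowers one dimension by one, which is seen exactly when its slot lies
  below \<open>k\<close>. With \<open>k\<close> a slot this tracks the Koszul sign; with
  \<open>k = Suc n\<close> it tracks the total degree.\<close>

lemma sum_sdim_delete_vertex:
  assumes "s \<in> finite_tuples n" "x \<in> faces n s"
  shows "(\<Sum>j=1..<k. sdim (delete_vertex s x j)) =
    (\<Sum>j=1..<k. sdim (s j)) - (if fst x < k then 1 else 0)"
proof (cases "fst x < k")
  case True
  obtain i v where x: "x = (i, v)" by (cases x)
  have i: "i \<in> {1..<k}" "finite (s i)" "v \<in> s i"
    using assms True by (auto simp: x faces_def finite_tuples_def dest!: PiE_mem)
  have "(\<Sum>j=1..<k. sdim (delete_vertex s x j)) =
      sdim (s i - {v}) + (\<Sum>j\<in>{1..<k} - {i}. sdim (s j))"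
    using i(1) by (subst sum.remove[of _ i]) (auto simp: x delete_vertex_def intro!: sum.cong)
  then show ?thesis using True sum.remove[OF _ i(1), of "\<lambda>j. sdim (s j)"] i
    by (simp add: sdim_delete)
qed (auto simp: delete_vertex_def intro!: sum.cong)

text \<open>Deleting the smaller \<open>x\<close> changes exactly one factor of the sign of
  \<open>y\<close>: in an earlier slot it lowers the dimension sum by one, in the same slot it
  removes one vertex below that of \<open>y\<close>. Deleting the larger \<open>y\<close> affects
  neither factor of the sign of \<open>x\<close>.\<close>

lemma face_sign_swap:
  assumes s: "s \<in> finite_tuples n" and x: "x \<in> faces n s" and y: "y \<in> faces n s"
    and less: "face_less r x y" and r: "antisym r"
  shows "face_sign r (delete_vertex s x) y = - (face_sign r s y :: 'k::comm_ring_1)"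
    and "face_sign r (delete_vertex s y) x = (face_sign r s x :: 'k)"
proof -
  obtain i v j w where xy: "x = (i, v)" "y = (j, w)" by (cases x, cases y)
  have fin: "finite (s i)" and v: "v \<in> s i"
    using s x by (auto simp: xy finite_tuples_def faces_def dest!: PiE_mem)
  note sums = sum_sdim_delete_vertex[OF s x] sum_sdim_delete_vertex[OF s y]
  show "face_sign r (delete_vertex s x) y = - (face_sign r s y :: 'k)"
  proof (cases "i < j")
    case True
    then show ?thesis
      by (simp add: face_sign_def sums pm_one_diff_1 del: One_nat_def)
        (simp add: xy delete_vertex_def pm_one_diff_1)
  next
    case False
    then have ij: "i = j" and vw: "v \<noteq> w" "(v, w) \<in> r"
      using less by (auto simp: face_less_def xy)
    let ?U = "{u \<in> s i. u \<noteq> w \<and> (u, w) \<in> r}"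
    have "{u \<in> s i - {v}. u \<noteq> w \<and> (u, w) \<in> r} = ?U - {v}" by auto
    moreover have "v \<in> ?U" "finite ?U" using v vw fin by auto
    \<comment> \<open>\<open>sdim\<close> is cardinality minus one for any finite set, so
      \<open>sdim_delete\<close> also counts the removal of \<open>v\<close> from the set of
      vertices below \<open>w\<close>.\<close>
    ultimately have "int (card {u \<in> s i - {v}. u \<noteq> w \<and> (u, w) \<in> r}) = int (card ?U) - 1"
      using sdim_delete[of ?U v] by (simp add: sdim_def)
    then show ?thesis using ij
      by (simp add: face_sign_def sums del: One_nat_def)
        (simp add: xy delete_vertex_def pm_one_diff_1)
  qed
  show "face_sign r (delete_vertex s y) x = (face_sign r s x :: 'k)"
  proof (cases "i < j")
    case True
    then show ?thesis
      by (simp add: face_sign_def sums del: One_nat_def) (simp add: xy delete_vertex_def)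
  next
    case False
    then have ij: "i = j" and vw: "v \<noteq> w" "(v, w) \<in> r"
      using less by (auto simp: face_less_def xy)
    \<comment> \<open>As \<open>v\<close> is below \<open>w\<close> and differs from it,
      antisymmetry keeps \<open>w\<close> out of the vertices below \<open>v\<close>, so removing
      \<open>w\<close> does not change the count.\<close>
    then have "{u \<in> s i - {w}. u \<noteq> v \<and> (u, v) \<in> r} = {u \<in> s i. u \<noteq> v \<and> (u, v) \<in> r}"
      using antisymD[OF r] by auto
    then show ?thesis using ij
      by (simp add: face_sign_def sums del: One_nat_def) (simp add: xy delete_vertex_def)
  qed
qed

text \<open>
  In characteristic 2 the antisymmetry of \<open>h\<close> alone does not force the sum to vanish; the relation
  \<open>prec\<close> selects one representative of each pair of cancelling terms.
\<close>

lemma sum_antisymmetric_eq_0: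
  fixes h :: "'a \<Rightarrow> 'a \<Rightarrow> 'b::ab_group_add"
  assumes fin: "finite W" and sym: "\<And>x y. (x, y) \<in> W \<Longrightarrow> (y, x) \<in> W"
    and total: "\<And>x y. (x, y) \<in> W \<Longrightarrow> prec x y \<or> prec y x"
    and asym: "\<And>x y. prec x y \<Longrightarrow> \<not> prec y x"
    and anti: "\<And>x y. (x, y) \<in> W \<Longrightarrow> prec x y \<Longrightarrow> h y x = - h x y"
  shows "(\<Sum>(x, y)\<in>W. h x y) = 0"
proof -
  let ?L = "{(x, y) \<in> W. prec x y}"
  have W: "W = ?L \<union> prod.swap ` ?L" "?L \<inter> prod.swap ` ?L = {}"
    using sym total asym by (fastforce simp: image_iff)+
  have "finite ?L" using fin by (rule rev_finite_subset) auto
  then have "(\<Sum>(x, y)\<in>?L \<union> prod.swap ` ?L. h x y) = (\<Sum>(x, y)\<in>?L. h x y) + (\<Sum>(x, y)\<in>prod.swap ` ?L. h x y)"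
    using W(2) by (intro sum.union_disjoint) auto
  also have "(\<Sum>(x, y)\<in>prod.swap ` ?L. h x y) = (\<Sum>(x, y)\<in>?L. h y x)"
    by (subst sum.reindex) (auto intro!: sum.cong)
  also have "\<dots> = (\<Sum>(x, y)\<in>?L. - h x y)"
    using anti by (intro sum.cong) auto
  finally show ?thesis using W(1) by (simp add: case_prod_unfold sum_negf)
qed

lemma delete_vertex_commute:
  "delete_vertex (delete_vertex s x) y = delete_vertex (delete_vertex s y) x"
  by (auto simp: delete_vertex_def fun_eq_iff)

text \<open>A slot that survives both deletions survives each of them alone, so the set of pairs of
  successive deletions is symmetric.\<close>

lemma faces_delete_vertex:
  "x \<in> faces n s \<and> y \<in> faces n (delete_vertex s x) \<Longrightarrow>
   y \<in> faces n s \<and> x \<in> faces n (delete_vertex s y)"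
  by (cases x; cases y) (auto simp: faces_def delete_vertex_def split: if_splits)

text \<open>Expanding twice gives a sum over ordered pairs of deletions. Both orders end at the same
  basis element, and \<open>face_sign_swap\<close> makes the two coefficients opposite. The set
  \<open>V\<close> ensures that \<open>r\<close> compares all vertices that occur.\<close>

lemma tensor_diff_tensor_diff_single:
  assumes s: "s \<in> finite_tuples n" and V: "\<And>i. i \<in> {1..n} \<Longrightarrow> s i \<subseteq> V" and r: "linear_order_on V r"
  shows "tensor_diff r n (tensor_diff r n (Poly_Mapping.single s (1::'k::field))) = 0"
proof -
  let ?h = "\<lambda>x y. chain_scale (face_sign r s x * face_sign r (delete_vertex s x) y)
    (Poly_Mapping.single (delete_vertex (delete_vertex s x) y) (1::'k))"
  have "tensor_diff r n (tensor_diff r n (Poly_Mapping.single s (1::'k))) =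
      (\<Sum>x\<in>faces n s. \<Sum>y\<in>faces n (delete_vertex s x). ?h x y)"
    by (simp add: tensor_diff_single s delete_vertex_finite_tuples tensor_diff.sum tensor_diff.scale
        chain.scale_sum_right)
  also have "\<dots> = (\<Sum>(x, y)\<in>(SIGMA x:faces n s. faces n (delete_vertex s x)). ?h x y)"
    using s by (intro sum.Sigma) (auto intro: finite_faces delete_vertex_finite_tuples)
  also have "\<dots> = 0"
  proof (rule sum_antisymmetric_eq_0[of _ "face_less r"])
    show "finite (SIGMA x:faces n s. faces n (delete_vertex s x))"
      using s by (intro finite_SigmaI) (auto intro: finite_faces delete_vertex_finite_tuples)
  next
    fix x y assume "(x, y) \<in> (SIGMA x:faces n s. faces n (delete_vertex s x))"
    then have xy: "x \<in> faces n s" "y \<in> faces n s" "y \<in> faces n (delete_vertex s x)"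
        "x \<in> faces n (delete_vertex s y)"
      using faces_delete_vertex[of x n s y] by auto
    then show "(y, x) \<in> (SIGMA x:faces n s. faces n (delete_vertex s x))" by simp
    \<comment> \<open>The same vertex cannot be deleted twice from a slot; distinctness is what
      totality of \<open>r\<close> requires.\<close>
    have "x \<noteq> y" using xy by (auto simp: faces_def delete_vertex_def)
    moreover have "snd x \<in> V" "snd y \<in> V" using xy V by (fastforce simp: faces_def)+
    ultimately show "face_less r x y \<or> face_less r y x"
      using r by (cases x; cases y)
        (auto simp: face_less_def linear_order_on_def total_on_def not_less_iff_gr_or_eq)
    assume "face_less r x y"
    then show "?h y x = - ?h x y"
      using face_sign_swap[OF s xy(1,2), of r, where ?'k = 'k] r
      by (simp add: delete_vertex_commute[of s y x] linear_order_on_def partial_order_on_def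
          mult.commute)
  next
    show "\<not> face_less r y x" if "face_less r x y" for x y
      using that r by (auto simp: face_less_def linear_order_on_def partial_order_on_def
        dest: antisymD)
  qed
  finally show ?thesis .
qed

lemma tensor_diff_tensor_diff:
  fixes t :: "('v, 'k::field) tens"
  assumes t: "t \<in> supported S" and S: "S \<subseteq> finite_tuples n" "\<And>s i. s \<in> S \<Longrightarrow> i \<in> {1..n} \<Longrightarrow> s i \<subseteq> V"
    and r: "linear_order_on V r"
  shows "tensor_diff r n (tensor_diff r n t) = 0"
proof -
  have "tensor_diff r n (tensor_diff r n t) = (\<Sum>s\<in>Poly_Mapping.keys t. chain_scale (Poly_Mapping.lookup t s)
      (tensor_diff r n (tensor_diff r n (Poly_Mapping.single s 1))))"
    by (subst chain_decomp) (simp only: tensor_diff.sum tensor_diff.scale)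
  also have "\<dots> = (\<Sum>s\<in>Poly_Mapping.keys t. 0)"
  proof (intro sum.cong refl)
    fix s assume "s \<in> Poly_Mapping.keys t"
    then have "s \<in> S" using t by (auto simp: supported_def)
    then have "tensor_diff r n (tensor_diff r n (Poly_Mapping.single s (1::'k))) = 0"
      using S by (intro tensor_diff_tensor_diff_single[OF _ _ r]) blast+
    then show "chain_scale (Poly_Mapping.lookup t s)
      (tensor_diff r n (tensor_diff r n (Poly_Mapping.single s 1))) = 0" by simp
  qed
  finally show ?thesis by simp
qed

section \<open>Homology of a quotient complex\<close>

text \<open>The coset \<open>N +> x\<close> of any \<open>module_on\<close>, freed of the record
  because neither the carrier nor the scalars influence it.\<close>

definition coset :: "'m::ab_group_add set \<Rightarrow> 'm \<Rightarrow> 'm set" where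
  "coset N x = (\<lambda>y. y + x) ` N"

lemma a_r_coset_module_on: "N +>\<^bsub>module_on A s\<^esub> x = coset N x"
  by (auto simp: a_r_coset_def' module_on_def coset_def)

lemma carrier_module_on [simp]: "carrier (module_on A s) = A"
  and add_module_on [simp]: "x \<oplus>\<^bsub>module_on A s\<^esub> y = x + y"
  and smult_module_on [simp]: "a \<odot>\<^bsub>module_on A s\<^esub> x = s a x"
  and zero_module_on [simp]: "\<zero>\<^bsub>module_on A s\<^esub> = 0"
  and update_carrier_module_on [simp]: "module_on A s\<lparr>carrier := B\<rparr> = module_on B s"
  by (simp_all add: module_on_def)

text \<open>Operations on quotients are unions over representatives; this collapses such a union
  once independence of the representative is known.\<close>

lemma UN_eq_const: "I \<noteq> {} \<Longrightarrow> (\<And>i. i \<in> I \<Longrightarrow> f i = c) \<Longrightarrow> (\<Union>i\<in>I. f i) = c"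
  by auto

lemma carrier_quotient_module: "carrier (quotient_module (module_on A s) N) = coset N ` A"
  by (auto simp: quotient_module_def A_RCOSETS_def' a_r_coset_module_on)

lemma zero_quotient_module [simp]: "\<zero>\<^bsub>quotient_module M N\<^esub> = N"
  by (simp add: quotient_module_def)

lemma a_r_coset_update_carrier: "N +>\<^bsub>M\<lparr>carrier := A\<rparr>\<^esub> x = N +>\<^bsub>M\<^esub> x"
  by (simp add: a_r_coset_def')

lemma add_homology_module: "X \<oplus>\<^bsub>homology C d e p\<^esub> Y = set_add (C p) X Y"
  by (simp add: homology_def quotient_module_def set_add_def')

lemma smult_homology_module:
  "a \<odot>\<^bsub>homology C d e p\<^esub> X = (\<Union>x\<in>X. boundaries C d e p +>\<^bsub>C p\<^esub> (a \<odot>\<^bsub>C p\<^esub> x))"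
  by (simp add: homology_def quotient_module_def a_r_coset_update_carrier)

context vector_space
begin

lemma coset_eq_iff:
  assumes "subspace N"
  shows "coset N x = coset N y \<longleftrightarrow> x - y \<in> N"
proof
  assume "coset N x = coset N y"
  moreover have "x \<in> coset N x"
    unfolding coset_def by (rule image_eqI[of _ _ 0]) (simp_all add: subspace_0[OF assms])
  ultimately show "x - y \<in> N" by (auto simp: coset_def)
next
  assume *: "x - y \<in> N"
  have "coset N x \<subseteq> coset N y" if "x - y \<in> N" for x y
    unfolding coset_def
  proof (rule image_subsetI)
    fix w assume "w \<in> N"
    then show "w + x \<in> (\<lambda>y'. y' + y) ` N"
      using subspace_add[OF assms _ that] by (intro image_eqI[of _ _ "w + (x - y)"]) simp_all
  qed
  from this[OF *] this[of y x] show "coset N x = coset N y"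
    using subspace_neg[OF assms *] by simp
qed

lemma coset_0: "coset N 0 = N"
  by (simp add: coset_def)

lemma coset_eq_self_iff: "subspace N \<Longrightarrow> coset N x = N \<longleftrightarrow> x \<in> N"
  using coset_eq_iff[of N x 0] by (simp add: coset_0)

lemma add_quotient_module:
  assumes N: "subspace N"
  shows "coset N x \<oplus>\<^bsub>quotient_module (module_on A scale) N\<^esub> coset N y = coset N (x + y)"
proof
  show "coset N x \<oplus>\<^bsub>quotient_module (module_on A scale) N\<^esub> coset N y \<subseteq> coset N (x + y)"
  proof
    fix w assume "w \<in> coset N x \<oplus>\<^bsub>quotient_module (module_on A scale) N\<^esub> coset N y"
    then obtain u v where "u \<in> N" "v \<in> N" "w = (u + x) + (v + y)"
      by (auto simp: quotient_module_def set_add_def' coset_def)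
    then show "w \<in> coset N (x + y)"
      using subspace_add[OF N] by (auto simp: coset_def algebra_simps intro!: image_eqI[of _ _ "u + v"])
  qed
  show "coset N (x + y) \<subseteq> coset N x \<oplus>\<^bsub>quotient_module (module_on A scale) N\<^esub> coset N y"
  proof
    fix w assume "w \<in> coset N (x + y)"
    \<comment> \<open>The whole contribution from \<open>N\<close> goes to the first coset and 0 to
      the second.\<close>
    then obtain u where "u \<in> N" "w = (u + x) + (0 + y)" by (auto simp: coset_def add.assoc)
    then have "\<exists>h\<in>N. \<exists>k\<in>N. w = (h + x) + (k + y)" using subspace_0[OF N] by blast
    then show "w \<in> coset N x \<oplus>\<^bsub>quotient_module (module_on A scale) N\<^esub> coset N y"
      by (simp add: quotient_module_def set_add_def' coset_def)
  qed
qed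

lemma coset_nonempty: "subspace N \<Longrightarrow> coset N x \<noteq> {}"
  using subspace_0[of N] by (auto simp: coset_def)

text \<open>All representatives yield the same coset after scaling. Because a union of cosets is
  formed rather than an image, the scalar 0 gives \<open>N\<close> and not just the set containing
  0.\<close>

lemma smult_quotient_module:
  assumes N: "subspace N"
  shows "a \<odot>\<^bsub>quotient_module (module_on A scale) N\<^esub> coset N x = coset N (a *s x)"
proof -
  have "coset N (a *s w) = coset N (a *s x)" if "w \<in> coset N x" for w
  proof -
    obtain y where "y \<in> N" "w = y + x" using \<open>w \<in> coset N x\<close> by (auto simp: coset_def)
    then show ?thesis
      using subspace_scale[OF N] by (simp add: coset_eq_iff[OF N] scale_right_distrib)
  qed
  then show ?thesis
    using UN_eq_const[OF coset_nonempty[OF N], of x "\<lambda>w. coset N (a *s w)"]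
    by (simp add: quotient_module_def a_r_coset_module_on)
qed

end

section \<open>The homology of a quotient in terms of relative cycles\<close>

locale quotient_complex = vector_space scale
  for scale :: "'k::field \<Rightarrow> 'm::ab_group_add \<Rightarrow> 'm" (infixr \<open>*s\<close> 75) +
  fixes T D :: "int \<Rightarrow> 'm set" and d :: "'m \<Rightarrow> 'm"
  assumes subspace_T: "subspace (T p)" and subspace_D: "subspace (D p)"
    and linear_d: "Vector_Spaces.linear scale scale d"
    and d_T: "t \<in> T p \<Longrightarrow> d t \<in> T (p - 1)" and d_D: "t \<in> D p \<Longrightarrow> d t \<in> D (p - 1)"
    and D_T: "D p \<subseteq> T p" and d_d: "t \<in> T p \<Longrightarrow> d (d t) = 0"
begin

sublocale d: Vector_Spaces.linear scale scale d
  by (rule linear_d)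

definition quotient :: "int \<Rightarrow> ('k, 'm set) module" where
  "quotient p = quotient_module (module_on (T p) scale) (D p)"

definition quotient_diff :: "int \<Rightarrow> 'm set \<Rightarrow> 'm set" where
  "quotient_diff p X = (\<Union>t\<in>X. D (p - 1) +>\<^bsub>module_on (T (p - 1)) scale\<^esub> d t)"

definition rel_cycles :: "int \<Rightarrow> 'm set" where
  "rel_cycles p = {t \<in> T p. d t \<in> D (p - 1)}"

definition rel_boundaries :: "int \<Rightarrow> 'm set" where
  "rel_boundaries p = {d u + y |u y. u \<in> T (p + 1) \<and> y \<in> D p}"

text \<open>A homology class of the quotient is a set of cosets of \<open>D p\<close>. Naming it by
  a lift \<open>t\<close> in \<open>T p\<close> avoids handling the nested quotients
  directly.\<close>

definition homology_class :: "int \<Rightarrow> 'm \<Rightarrow> 'm set set" where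
  "homology_class p t = (\<lambda>u. coset (D p) (d u + t)) ` T (p + 1)"

lemma quotient_diff_coset: "quotient_diff p (coset (D p) t) = coset (D (p - 1)) (d t)"
proof -
  have "coset (D (p - 1)) (d w) = coset (D (p - 1)) (d t)" if "w \<in> coset (D p) t" for w
    using that d_D by (auto simp: coset_def[of "D p"] coset_eq_iff[OF subspace_D] d.add)
  then show ?thesis
    using UN_eq_const[OF coset_nonempty[OF subspace_D], of _ t "\<lambda>w. coset (D (p - 1)) (d w)"]
    by (simp add: quotient_diff_def a_r_coset_module_on)
qed

lemma cycles_quotient: "cycles quotient quotient_diff (-1) p = coset (D p) ` rel_cycles p"
proof -
  have "quotient_diff p (coset (D p) t) = \<zero>\<^bsub>quotient (p + - 1)\<^esub> \<longleftrightarrow> d t \<in> D (p - 1)" for t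
    by (simp add: quotient_def quotient_diff_coset coset_eq_self_iff[OF subspace_D])
  then show ?thesis
    unfolding cycles_def rel_cycles_def quotient_def carrier_quotient_module by blast
qed

lemma boundaries_quotient:
  "boundaries quotient quotient_diff (-1) p = (\<lambda>u. coset (D p) (d u)) ` T (p + 1)"
  using quotient_diff_coset[of "p + 1"]
  by (simp add: boundaries_def quotient_def carrier_quotient_module image_image)

lemma class_quotient:
  "boundaries quotient quotient_diff (-1) p +>\<^bsub>quotient p\<^esub> coset (D p) t = homology_class p t"
  by (auto simp: a_r_coset_def' boundaries_quotient homology_class_def quotient_def
      add_quotient_module[OF subspace_D])

lemma smult_quotient: "a \<odot>\<^bsub>quotient p\<^esub> coset (D p) t = coset (D p) (a *s t)"
  by (simp add: quotient_def smult_quotient_module[OF subspace_D])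

lemma carrier_homology:
  "carrier (homology quotient quotient_diff (-1) p) = homology_class p ` rel_cycles p"
  by (auto simp: homology_def quotient_module_def A_RCOSETS_def' a_r_coset_update_carrier
      cycles_quotient class_quotient)

lemma subspace_rel_cycles: "subspace (rel_cycles p)"
  using subspace_T subspace_D
  by (auto simp: rel_cycles_def subspace_def d.zero d.add d.scale)

lemma subspace_rel_boundaries: "subspace (rel_boundaries p)"
proof -
  have "rel_boundaries p = {x + y |x y. x \<in> d ` T (p + 1) \<and> y \<in> D p}"
    unfolding rel_boundaries_def by blast
  then show ?thesis
    using subspace_sums[OF d.subspace_image[OF subspace_T] subspace_D] by simp
qed

text \<open>A lift of a representative has the form \<open>y + (d u + t)\<close> with
  \<open>y\<close> in \<open>D p\<close> and \<open>u\<close> in \<open>T (p + 1)\<close>. This is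
  the freedom that \<open>psi\<close> must not see.\<close>

lemma homology_class_lift_diff: "w \<in> X \<Longrightarrow> X \<in> homology_class p t \<Longrightarrow> w - t \<in> rel_boundaries p"
  by (auto simp: homology_class_def coset_def rel_boundaries_def) (metis add.commute)

lemma homology_class_lift: "\<exists>X\<in>homology_class p t. t \<in> X"
  unfolding homology_class_def
  by (rule bexI[OF _ imageI[of 0]])
    (auto simp: coset_def d.zero subspace_0 subspace_T subspace_D intro!: image_eqI[of _ _ 0])

lemma homology_class_eqI:
  assumes "t - t' \<in> rel_boundaries p"
  shows "homology_class p t = homology_class p t'"
proof -
  have "homology_class p t \<subseteq> homology_class p t'" if diff: "t - t' \<in> rel_boundaries p" for t t'
    unfolding homology_class_def
  proof (rule image_subsetI)
    fix u assume u: "u \<in> T (p + 1)"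
    obtain v y where v: "v \<in> T (p + 1)" "y \<in> D p" "t - t' = d v + y"
      using diff unfolding rel_boundaries_def by blast
    \<comment> \<open>The index \<open>u + v\<close> on the side of \<open>t'\<close> corresponds to
      \<open>u\<close>; the remaining difference is \<open>y\<close>, which lies in
      \<open>D p\<close>.\<close>
    have "d u + t - (d (u + v) + t') = (t - t') - d v" by (simp add: d.add)
    then have "coset (D p) (d u + t) = coset (D p) (d (u + v) + t')"
      using v by (simp add: coset_eq_iff[OF subspace_D])
    then show "coset (D p) (d u + t) \<in> (\<lambda>u. coset (D p) (d u + t')) ` T (p + 1)"
      using u v(1) subspace_add[OF subspace_T] by blast
  qed
  from this[OF assms] this[of t' t] show ?thesis
    using subspace_neg[OF subspace_rel_boundaries assms] by simp
qed

lemma add_homology: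
  "homology_class p t \<oplus>\<^bsub>homology quotient quotient_diff (-1) p\<^esub> homology_class p t' =
    homology_class p (t + t')"
proof -
  have "homology_class p t \<oplus>\<^bsub>homology quotient quotient_diff (-1) p\<^esub> homology_class p t' =
      (\<Union>u\<in>T (p + 1). \<Union>v\<in>T (p + 1). {coset (D p) ((d u + t) + (d v + t'))})"
    by (simp add: add_homology_module set_add_def' homology_class_def quotient_def
        add_quotient_module[OF subspace_D])
  also have "\<dots> = homology_class p (t + t')"
  proof
    show "(\<Union>u\<in>T (p + 1). \<Union>v\<in>T (p + 1). {coset (D p) ((d u + t) + (d v + t'))})
        \<subseteq> homology_class p (t + t')"
    proof clarify
      fix u v assume "u \<in> T (p + 1)" "v \<in> T (p + 1)"
      then have uv: "u + v \<in> T (p + 1)" by (rule subspace_add[OF subspace_T])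
      have eq: "(d u + t) + (d v + t') = d (u + v) + (t + t')" by (simp add: d.add)
      show "coset (D p) ((d u + t) + (d v + t')) \<in> homology_class p (t + t')"
        unfolding homology_class_def eq by (rule imageI[OF uv])
    qed
    show "homology_class p (t + t')
        \<subseteq> (\<Union>u\<in>T (p + 1). \<Union>v\<in>T (p + 1). {coset (D p) ((d u + t) + (d v + t'))})"
      unfolding homology_class_def
    proof (rule image_subsetI)
      fix u assume u: "u \<in> T (p + 1)"
      \<comment> \<open>The boundary is attributed to the first summand, and the index 0 is used for
        the second.\<close>
      have eq: "d u + (t + t') = (d u + t) + (d 0 + t')" by (simp add: d.zero add.assoc)
      show "coset (D p) (d u + (t + t'))
          \<in> (\<Union>u\<in>T (p + 1). \<Union>v\<in>T (p + 1). {coset (D p) ((d u + t) + (d v + t'))})"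
        unfolding eq by (intro UN_I[OF u] UN_I[OF subspace_0[OF subspace_T]] singletonI)
    qed
  qed
  finally show ?thesis .
qed

text \<open>Replacing \<open>t\<close> by \<open>d u + t\<close> changes the scaled lift by
  \<open>d (a *s u)\<close>, a relative boundary, so every term of the union is the same
  class.\<close>

lemma smult_homology:
  "a \<odot>\<^bsub>homology quotient quotient_diff (-1) p\<^esub> homology_class p t = homology_class p (a *s t)"
proof -
  have "homology_class p (a *s (d u + t)) = homology_class p (a *s t)" if "u \<in> T (p + 1)" for u
    using that subspace_scale[OF subspace_T] subspace_0[OF subspace_D]
    by (intro homology_class_eqI) (force simp: rel_boundaries_def scale_right_distrib d.scale)
  moreover have "T (p + 1) \<noteq> {}" using subspace_0[OF subspace_T] by blast
  ultimately have "(\<Union>u\<in>T (p + 1). homology_class p (a *s (d u + t))) = homology_class p (a *s t)"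
    by (intro UN_eq_const)
  then show ?thesis
    by (simp add: smult_homology_module homology_class_def[of p t] class_quotient
        smult_quotient)
qed

end

section \<open>Interaction cochains\<close>

abbreviation functionals :: "'a set \<Rightarrow> (('a \<Rightarrow>\<^sub>0 'k::field) \<Rightarrow> 'k) set" where
  "functionals S \<equiv> carrier (dual_module (module_on (supported S) chain_scale))"

lemma dual_module_iff:
  "\<phi> \<in> carrier (dual_module M) \<longleftrightarrow>
    (\<forall>x\<in>carrier M. \<forall>y\<in>carrier M. \<phi> (x \<oplus>\<^bsub>M\<^esub> y) = \<phi> x + \<phi> y) \<and>
    (\<forall>a. \<forall>x\<in>carrier M. \<phi> (a \<odot>\<^bsub>M\<^esub> x) = a * \<phi> x) \<and> (\<forall>x. x \<notin> carrier M \<longrightarrow> \<phi> x = 0)"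
  by (auto simp: dual_module_def lin_hom_def hom_def)

lemma functionals_iff:
  "f \<in> functionals S \<longleftrightarrow>
    (\<forall>x\<in>supported S. \<forall>y\<in>supported S. f (x + y) = f x + f y) \<and>
    (\<forall>a. \<forall>x\<in>supported S. f (chain_scale a x) = a * f x) \<and> (\<forall>x. x \<notin> supported S \<longrightarrow> f x = 0)"
  by (simp add: dual_module_iff)

lemma subspace_functionals:
  "functional.subspace (functionals S :: (('a \<Rightarrow>\<^sub>0 'k::field) \<Rightarrow> 'k) set)"
  by (rule functional.subspaceI; unfold functionals_iff)
    (auto simp: fun_scale_def algebra_simps)

text \<open>\<open>f\<close> is linear only on \<open>supported S\<close>, so the expansion must
  keep every partial sum inside that subspace.\<close>

lemma functional_expand:
  assumes f: "f \<in> functionals S" and t: "t \<in> supported S"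
  shows "f t = (\<Sum>s\<in>Poly_Mapping.keys t. Poly_Mapping.lookup t s * f (Poly_Mapping.single s 1))"
proof -
  have f0: "f 0 = 0"
    using f t unfolding functionals_iff by (metis chain.scale_zero_left mult_zero_left)
  have "f (\<Sum>s\<in>A. chain_scale (a s) (Poly_Mapping.single s 1)) =
      (\<Sum>s\<in>A. a s * f (Poly_Mapping.single s 1))" if "A \<subseteq> S" for A a
    using that
  proof (induction A rule: infinite_finite_induct)
    case (insert s A)
    let ?t = "\<Sum>s\<in>A. chain_scale (a s) (Poly_Mapping.single s 1)"
    have "?t \<in> supported S"
      using insert.prems
      by (intro chain.subspace_sum[OF subspace_supported]
          chain.subspace_scale[OF subspace_supported]) auto
    moreover have s: "Poly_Mapping.single s 1 \<in> supported S" using insert.prems by simp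
    moreover have "chain_scale (a s) (Poly_Mapping.single s 1) \<in> supported S"
      by (rule chain.subspace_scale[OF subspace_supported s])
    ultimately show ?case
      using insert f unfolding functionals_iff by simp
  qed (simp_all add: f0)
  from this[of "Poly_Mapping.keys t" "Poly_Mapping.lookup t"] show ?thesis
    using t chain_decomp[of t] by (simp add: supported_def)
qed

lemma functional_eqI:
  assumes "f \<in> functionals S" "g \<in> functionals S"
    and "\<And>s. s \<in> S \<Longrightarrow> f (Poly_Mapping.single s 1) = g (Poly_Mapping.single s 1)"
  shows "f = g"
proof
  fix t
  show "f t = g t"
  proof (cases "t \<in> supported S")
    case True
    then show ?thesis
      unfolding functional_expand[OF assms(1) True] functional_expand[OF assms(2) True]
      using assms(3) by (intro sum.cong) (auto simp: supported_def)
  qed (use assms in \<open>simp add: functionals_iff\<close>)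
qed

definition functional_of :: "'a set \<Rightarrow> ('a \<Rightarrow> 'k) \<Rightarrow> ('a \<Rightarrow>\<^sub>0 'k::field) \<Rightarrow> 'k" where
  "functional_of S \<phi> t =
    (if t \<in> supported S then \<Sum>s\<in>Poly_Mapping.keys t. Poly_Mapping.lookup t s * \<phi> s else 0)"

lemma functional_of_in_functionals: "functional_of S \<phi> \<in> functionals S"
proof -
  have eq: "functional_of S \<phi> t = (\<Sum>s\<in>A. Poly_Mapping.lookup t s * \<phi> s)"
    if "finite A" "t \<in> supported S" "Poly_Mapping.keys t \<subseteq> A" for t A
    unfolding functional_of_def using that
    by (auto simp: in_keys_iff intro!: sum.mono_neutral_left)
  have "functional_of S \<phi> (x + y) = functional_of S \<phi> x + functional_of S \<phi> y"
    if "x \<in> supported S" "y \<in> supported S" for x y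
    using that keys_add[of x y] chain.subspace_add[OF subspace_supported that]
    by (simp add: eq[of "Poly_Mapping.keys x \<union> Poly_Mapping.keys y"] lookup_add distrib_right
        sum.distrib)
  moreover have "functional_of S \<phi> (chain_scale a x) = a * functional_of S \<phi> x"
    if "x \<in> supported S" for a x
    using that chain.subspace_scale[OF subspace_supported that, of a]
    by (subst (1 2) eq[of "Poly_Mapping.keys x"])
      (auto simp: in_keys_iff lookup_chain_scale sum_distrib_left mult.assoc)
  ultimately show ?thesis by (simp add: functionals_iff functional_of_def)
qed

lemma functional_of_single [simp]:
  "s \<in> S \<Longrightarrow> functional_of S \<phi> (Poly_Mapping.single s 1) = \<phi> s"
  by (simp add: functional_of_def)

text \<open>Turns a globally defined linear map into a cochain: cutting it off outside
  \<open>S'\<close> does no harm on \<open>supported S'\<close>. The factor \<open>c\<close> makes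
  room for the sign of the codifferential.\<close>

lemma functional_of_linear:
  assumes g: "Vector_Spaces.linear chain_scale (*) g" and t: "t \<in> supported S'" and "S' \<subseteq> S"
  shows "functional_of S (\<lambda>s. if s \<in> S' then c * g (Poly_Mapping.single s 1) else 0) t = c * g t"
proof -
  interpret g: Vector_Spaces.linear chain_scale "(*)" g by (rule g)
  have "g t = (\<Sum>s\<in>Poly_Mapping.keys t. Poly_Mapping.lookup t s * g (Poly_Mapping.single s 1))"
    by (subst chain_decomp) (simp only: g.sum g.scale)
  moreover have "t \<in> supported S" using t supported_mono[OF \<open>S' \<subseteq> S\<close>] by blast
  ultimately show ?thesis
    using t by (auto simp: functional_of_def supported_def sum_distrib_left mult.left_commute
        intro!: sum.cong)
qed

text \<open>A description of the cochain module by values on the basis, without reference to a span;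
  \<open>carrier_IC_co\<close> shows that the two agree.\<close>

definition cochains ::
    "nat \<Rightarrow> (nat \<Rightarrow> 'v set set) \<Rightarrow> int \<Rightarrow> (('v, 'k::field) tens \<Rightarrow> 'k) set" where
  "cochains n Ks p = {f \<in> functionals (\<Pi>\<^sub>E i\<in>{1..n}. Ks i). \<forall>s\<in>\<Pi>\<^sub>E i\<in>{1..n}. Ks i.
     f (Poly_Mapping.single s 1) \<noteq> 0 \<longrightarrow> s \<in> tuples_deg n Ks p \<and> s \<notin> empty_tuples n}"

lemma subspace_cochains:
  "functional.subspace (cochains n Ks p :: (('v, 'k::field) tens \<Rightarrow> 'k) set)"
  unfolding functional.subspace_def cochains_def functionals_iff mem_Collect_eq
  by (auto simp: fun_scale_def algebra_simps)

lemma cochain_eq_0: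
  assumes f: "f \<in> cochains n Ks p" and t: "t \<in> supported S" "S \<subseteq> (\<Pi>\<^sub>E i\<in>{1..n}. Ks i)"
    and S: "\<And>s. s \<in> S \<Longrightarrow> s \<notin> tuples_deg n Ks p \<or> s \<in> empty_tuples n"
  shows "f t = 0"
proof -
  have "t \<in> supported (\<Pi>\<^sub>E i\<in>{1..n}. Ks i)" using t supported_mono by blast
  then have "f t = (\<Sum>s\<in>Poly_Mapping.keys t. Poly_Mapping.lookup t s * f (Poly_Mapping.single s 1))"
    using f by (intro functional_expand) (auto simp: cochains_def)
  also have "\<dots> = 0"
  proof (rule sum.neutral, rule ballI)
    fix s assume "s \<in> Poly_Mapping.keys t"
    then have "s \<in> S" using t(1) by (auto simp: supported_def)
    then have "f (Poly_Mapping.single s 1) = 0"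
      using f t(2) S[of s] unfolding cochains_def by blast
    then show "Poly_Mapping.lookup t s * f (Poly_Mapping.single s 1) = 0" by simp
  qed
  finally show ?thesis .
qed

lemma sum_fun_apply: "(\<Sum>i\<in>A. f i) x = (\<Sum>i\<in>A. f i x)"
  for f :: "'i \<Rightarrow> 'a \<Rightarrow> 'b::comm_monoid_add"
  by (induction A rule: infinite_finite_induct) auto

text \<open>A generator lives in a single multidegree \<open>q\<close>, and its support is then in
  total degree \<open>p\<close>. Conversely a functional of total degree \<open>p\<close> is the sum
  of its multidegree components, a finite sum because simplices are nonempty and hence have
  dimensions between 0 and \<open>p\<close>.\<close>

lemma carrier_IC_co:
  assumes Ks: "\<And>i. i \<in> {1..n} \<Longrightarrow> simplicial_complex (Ks i)"
  shows "(carrier (IC_co n Ks p) :: (('v, 'k::field) tens \<Rightarrow> 'k) set) = cochains n Ks p"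
proof -
  let ?S = "\<Pi>\<^sub>E i\<in>{1..n}. Ks i"
  let ?e = "\<lambda>s. Poly_Mapping.single s (1::'k)"
  have simplex: "simplex_tensor n s = ?e s" if "s \<in> ?S" for s
    using that by (simp add: simplex_tensor_eq)
  \<comment> \<open>The definitions quantify over all functions on the naturals, the basis consists
    of extensional ones; \<open>restrict\<close> translates between them.\<close>
  have pcochain_iff: "f \<in> interaction_pcochains n Ks p \<longleftrightarrow> f \<in> functionals ?S \<and>
      (\<forall>s\<in>?S. s \<in> empty_tuples n \<longrightarrow> f (?e s) = 0) \<and>
      (\<exists>q. (\<Sum>i=1..n. q i) = p \<and> (\<forall>s\<in>?S. (\<exists>i\<in>{1..n}. sdim (s i) \<noteq> q i) \<longrightarrow> f (?e s) = 0))"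
    for f :: "('v, 'k) tens \<Rightarrow> 'k"
  proof -
    have restrict: "restrict s {1..n} \<in> ?S \<longleftrightarrow> (\<forall>i\<in>{1..n}. s i \<in> Ks i)" for s
      by (simp add: PiE_iff)
    have Inter: "restrict s {1..n} \<in> empty_tuples n \<longleftrightarrow> (\<Inter>i\<in>{1..n}. s i) = {}" for s
    proof -
      have "(\<Inter>i\<in>{1..n}. restrict s {1..n} i) = (\<Inter>i\<in>{1..n}. s i)" by (rule INF_cong) auto
      then show ?thesis by (simp only: empty_tuples_def mem_Collect_eq)
    qed
    have "(\<forall>s\<in>disjoint_tuples n Ks. f (simplex_tensor n s) = 0) \<longleftrightarrow>
        (\<forall>s\<in>?S. s \<in> empty_tuples n \<longrightarrow> f (?e s) = 0)"
    proof (intro iffI ballI impI)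
      fix s assume *: "\<forall>s\<in>disjoint_tuples n Ks. f (simplex_tensor n s) = 0" "s \<in> ?S" "s \<in> empty_tuples n"
      then have "s \<in> disjoint_tuples n Ks"
        unfolding disjoint_tuples_def empty_tuples_def by (auto simp del: One_nat_def)
      then show "f (?e s) = 0" using *(1) simplex[OF *(2)] by metis
    next
      fix s assume *: "\<forall>s\<in>?S. s \<in> empty_tuples n \<longrightarrow> f (?e s) = 0" "s \<in> disjoint_tuples n Ks"
      then show "f (simplex_tensor n s) = 0"
        using restrict[of s] Inter[of s] unfolding simplex_tensor_eq disjoint_tuples_def by blast
    qed
    moreover have "(\<forall>s. (\<forall>i\<in>{1..n}. s i \<in> Ks i) \<and> (\<exists>i\<in>{1..n}. sdim (s i) \<noteq> q i) \<longrightarrow>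
        f (simplex_tensor n s) = 0) \<longleftrightarrow> (\<forall>s\<in>?S. (\<exists>i\<in>{1..n}. sdim (s i) \<noteq> q i) \<longrightarrow> f (?e s) = 0)"
      for q
    proof (intro iffI ballI impI allI)
      fix s assume *: "\<forall>s. (\<forall>i\<in>{1..n}. s i \<in> Ks i) \<and> (\<exists>i\<in>{1..n}. sdim (s i) \<noteq> q i) \<longrightarrow>
        f (simplex_tensor n s) = 0" "s \<in> ?S" "\<exists>i\<in>{1..n}. sdim (s i) \<noteq> q i"
      then show "f (?e s) = 0" using simplex[OF *(2)] PiE_mem[OF *(2)] by metis
    next
      fix s assume *: "\<forall>s\<in>?S. (\<exists>i\<in>{1..n}. sdim (s i) \<noteq> q i) \<longrightarrow> f (?e s) = 0"
        "(\<forall>i\<in>{1..n}. s i \<in> Ks i) \<and> (\<exists>i\<in>{1..n}. sdim (s i) \<noteq> q i)"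
      moreover from *(2) have "\<exists>i\<in>{1..n}. sdim (restrict s {1..n} i) \<noteq> q i" by auto
      ultimately show "f (simplex_tensor n s) = 0"
        using restrict[of s] unfolding simplex_tensor_eq by blast
    qed
    ultimately show ?thesis
      unfolding interaction_pcochains_def interaction_cochains_def tensor_product_eq mem_Collect_eq
      by (simp only: conj_assoc)
  qed
  have "functional.span (interaction_pcochains n Ks p) = (cochains n Ks p :: (('v, 'k) tens \<Rightarrow> 'k) set)"
  proof
    show "functional.span (interaction_pcochains n Ks p) \<subseteq> (cochains n Ks p :: (('v, 'k) tens \<Rightarrow> 'k) set)"
    proof (rule functional.span_minimal[OF _ subspace_cochains], rule subsetI)
      fix f :: "('v, 'k) tens \<Rightarrow> 'k"
      assume "f \<in> interaction_pcochains n Ks p"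
      then obtain q where f: "f \<in> functionals ?S" "\<forall>s\<in>?S. s \<in> empty_tuples n \<longrightarrow> f (?e s) = 0"
        and q: "(\<Sum>i=1..n. q i) = p" "\<forall>s\<in>?S. (\<exists>i\<in>{1..n}. sdim (s i) \<noteq> q i) \<longrightarrow> f (?e s) = 0"
        unfolding pcochain_iff by blast
      have "s \<in> tuples_deg n Ks p" if s: "s \<in> ?S" "f (?e s) \<noteq> 0" for s
      proof -
        have "(\<Sum>i=1..n. sdim (s i)) = (\<Sum>i=1..n. q i)"
          using s q(2) by (intro sum.cong) blast+
        then show ?thesis using s q(1) unfolding tuples_deg_def by blast
      qed
      then show "f \<in> cochains n Ks p" using f unfolding cochains_def by blast
    qed
    show "(cochains n Ks p :: (('v, 'k) tens \<Rightarrow> 'k) set) \<subseteq> functional.span (interaction_pcochains n Ks p)"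
    proof
      fix f :: "('v, 'k) tens \<Rightarrow> 'k"
      assume f: "f \<in> cochains n Ks p"
      \<comment> \<open>A finite box containing every multidegree of total \<open>p\<close> with
        nonnegative entries, since then no entry exceeds the total.\<close>
      let ?Q = "\<Pi>\<^sub>E i\<in>{1..n}. {0..p}"
      let ?f = "\<lambda>q s. if \<forall>i\<in>{1..n}. sdim (s i) = q i then f (?e s) else 0"
      have "(\<Sum>q\<in>?Q. ?f q s) = f (?e s)" if s: "s \<in> ?S" for s
      proof (cases "f (?e s) = 0")
        case False
        then have p: "(\<Sum>i=1..n. sdim (s i)) = p"
          using f s unfolding cochains_def tuples_deg_def by blast
        have nonneg: "sdim (s i) \<ge> 0" if "i \<in> {1..n}" for i
        proof -
          have "finite (s i)" "s i \<noteq> {}"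
            using Ks[OF that] PiE_mem[OF s that] by (auto simp: simplicial_complex_def)
          then have "card (s i) > 0" by (simp add: card_gt_0_iff)
          then show ?thesis unfolding sdim_def by linarith
        qed
        \<comment> \<open>The multidegree of \<open>s\<close>, made extensional so that it is the
          only index in the box whose component sees \<open>s\<close>.\<close>
        let ?q = "\<lambda>i\<in>{1..n}. sdim (s i)"
        have "sdim (s i) \<le> p" if "i \<in> {1..n}" for i
          using member_le_sum[of i "{1..n}" "\<lambda>i. sdim (s i)"] that nonneg p by simp
        then have "?q \<in> ?Q" using nonneg by simp
        moreover have "?f q s = (if q = ?q then f (?e s) else 0)" if "q \<in> ?Q" for q
        proof -
          have "(\<forall>i\<in>{1..n}. sdim (s i) = q i) \<longleftrightarrow> q = ?q"
            using that by (auto simp: PiE_iff extensional_def fun_eq_iff)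
          then show ?thesis by simp
        qed
        ultimately show ?thesis
          by (simp add: finite_PiE cong: sum.cong)
      qed (simp cong: if_cong)
      then have "(\<Sum>q\<in>?Q. functional_of ?S (?f q) (?e s)) = f (?e s)" if "s \<in> ?S" for s
        using that by simp
      moreover have "(\<Sum>q\<in>?Q. functional_of ?S (?f q)) \<in> functionals ?S"
        by (intro functional.subspace_sum[OF subspace_functionals] functional_of_in_functionals)
      ultimately have "f = (\<Sum>q\<in>?Q. functional_of ?S (?f q))"
        using f by (intro functional_eqI[of _ ?S]) (auto simp: cochains_def sum_fun_apply)
      also have "\<dots> \<in> functional.span (interaction_pcochains n Ks p)"
      proof (intro functional.span_sum)
        fix q assume q: "q \<in> ?Q"
        show "functional_of ?S (?f q) \<in> functional.span (interaction_pcochains n Ks p)"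
        proof (cases "(\<Sum>i=1..n. q i) = p")
          case True
          have "functional_of ?S (?f q) \<in> interaction_pcochains n Ks p"
            unfolding pcochain_iff using True f
            by (intro conjI functional_of_in_functionals exI[of _ q])
              (auto simp: cochains_def simp del: One_nat_def)
          then show ?thesis by (rule functional.span_base)
        next
          \<comment> \<open>The box also contains multidegrees of other totals; their components
            vanish because \<open>f\<close> is concentrated in degree \<open>p\<close>.\<close>
          case False
          have "functional_of ?S (?f q) = 0"
          proof (rule functional_eqI[OF functional_of_in_functionals])
            show "0 \<in> functionals ?S" by (simp add: functionals_iff)
            fix s assume s: "s \<in> ?S"
            have "?f q s = 0"
            proof (rule ccontr)
              assume *: "?f q s \<noteq> 0"
              then have "(\<Sum>i=1..n. sdim (s i)) = (\<Sum>i=1..n. q i)"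
                by (intro sum.cong) (auto split: if_splits)
              moreover have "(\<Sum>i=1..n. sdim (s i)) = p"
                using * f s unfolding cochains_def tuples_deg_def by (auto split: if_splits)
              ultimately show False using False by simp
            qed
            then show "functional_of ?S (?f q) (?e s) = 0 (?e s)"
              using s by simp
          qed
          then show ?thesis by (simp add: functional.span_zero)
        qed
      qed
      finally show "f \<in> functional.span (interaction_pcochains n Ks p)" .
    qed
  qed
  then show ?thesis by (simp add: IC_co_def)
qed

section \<open>The universal coefficient isomorphism\<close>

interpretation functional_extension: vector_space_pair
  "chain_scale :: 'k::field \<Rightarrow> ('a \<Rightarrow>\<^sub>0 'k) \<Rightarrow> _" "(*) :: 'k::field \<Rightarrow> 'k \<Rightarrow> 'k"
  by unfold_locales (simp_all add: algebra_simps)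

interpretation IC_codiff: Vector_Spaces.linear fun_scale fun_scale
  "IC_codiff r n Ks p :: (('v, 'k::field) tens \<Rightarrow> 'k) \<Rightarrow> _"
  by unfold_locales (simp_all add: IC_codiff_def fun_scale_def fun_eq_iff distrib_left mult.left_commute)

lemma pm_one_sq: "pm_one p * pm_one p = (1 :: 'k::comm_ring_1)"
  by (simp add: pm_one_def)

section \<open>The interaction chain complex as a quotient complex\<close>

locale oriented_interaction_complex =
  fixes n :: nat and K :: "'v set set" and Ks :: "nat \<Rightarrow> 'v set set" and r :: "'v rel"
  assumes interaction: "interaction_complex n K Ks" and order: "linear_order_on (\<Union>K) r"
begin

abbreviation "S \<equiv> \<Pi>\<^sub>E i\<in>{1..n}. Ks i"

lemma simplicial: "i \<in> {1..n} \<Longrightarrow> simplicial_complex (Ks i)"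
  using interaction by (auto simp: interaction_complex_def)

lemma tuples_deg_subset: "tuples_deg n Ks p \<subseteq> S"
  by (auto simp: tuples_deg_def)

lemma S_subset: "S \<subseteq> finite_tuples n"
  unfolding finite_tuples_def using simplicial by (intro PiE_mono) (auto simp: simplicial_complex_def)

lemma vertices_S:
  assumes "s \<in> S" "i \<in> {1..n}"
  shows "s i \<subseteq> \<Union>K"
proof -
  have "s i \<in> Ks i" "Ks i \<subseteq> K"
    using assms interaction PiE_mem[of s] by (auto simp: interaction_complex_def)
  then show ?thesis by blast
qed

lemma delete_vertex_S:
  assumes s: "s \<in> S" and x: "x \<in> faces n s"
  shows "delete_vertex s x \<in> S"
proof -
  obtain i v where x_eq: "x = (i, v)" by (cases x)
  have iv: "i \<in> {1..n}" "s i - {v} \<noteq> {}"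
    using x by (simp_all add: x_eq faces_def)
  have "\<forall>\<tau>\<subseteq>s i. \<tau> \<noteq> {} \<longrightarrow> \<tau> \<in> Ks i"
    using simplicial[OF iv(1)] unfolding simplicial_complex_def
    by (elim conjE) (drule bspec[OF _ PiE_mem[OF s iv(1)]])
  then have "s i - {v} \<in> Ks i" using iv(2) by (metis Diff_subset)
  then have "s(i := s i - {v}) \<in> (\<Pi>\<^sub>E j\<in>insert i {1..n}. Ks j)"
    using s iv(1) by (auto simp: PiE_iff extensional_def)
  then show ?thesis using iv(1) by (simp add: x_eq delete_vertex_def insert_absorb)
qed

lemma delete_vertex_tuples_deg:
  assumes s: "s \<in> tuples_deg n Ks p" and x: "x \<in> faces n s"
  shows "delete_vertex s x \<in> tuples_deg n Ks (p - 1)"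
proof -
  \<comment> \<open>The range is written half-open so that \<open>sum_sdim_delete_vertex\<close>
    applies with \<open>k = Suc n\<close>, which lies above every slot.\<close>
  have *: "s \<in> S" "(\<Sum>i=1..<Suc n. sdim (s i)) = p"
    using s by (auto simp: tuples_deg_def atLeastLessThanSuc_atLeastAtMost)
  have "fst x < Suc n" using x by (auto simp: faces_def)
  moreover have "s \<in> finite_tuples n" using *(1) S_subset by blast
  ultimately have "(\<Sum>i=1..<Suc n. sdim (delete_vertex s x i)) = p - 1"
    using sum_sdim_delete_vertex[OF _ x, of "Suc n"] *(2) by simp
  then show ?thesis
    using delete_vertex_S[OF *(1) x] by (simp add: tuples_deg_def atLeastLessThanSuc_atLeastAtMost)
qed

text \<open>Deletion only shrinks simplices and hence their intersection; this is why
  \<open>D\<close> is a subcomplex.\<close>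

lemma delete_vertex_empty_tuples:
  assumes "s \<in> empty_tuples n"
  shows "delete_vertex s x \<in> empty_tuples n"
proof -
  have "(\<Inter>i\<in>{1..n}. delete_vertex s x i) \<subseteq> (\<Inter>i\<in>{1..n}. s i)"
    by (rule INF_mono') (auto simp: delete_vertex_def)
  then show ?thesis using assms by (simp only: empty_tuples_def mem_Collect_eq subset_empty)
qed

lemma tensor_diff_tuples_deg:
  "t \<in> supported (tuples_deg n Ks p) \<Longrightarrow>
    tensor_diff r n t \<in> (supported (tuples_deg n Ks (p - 1)) :: ('v, 'k::field) tens set)"
  by (erule tensor_diff_supported)
    (simp_all add: delete_vertex_tuples_deg order.trans[OF tuples_deg_subset S_subset])

lemma tensor_diff_S:
  "t \<in> supported S \<Longrightarrow> tensor_diff r n t \<in> (supported S :: ('v, 'k::field) tens set)"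
  by (erule tensor_diff_supported) (simp_all only: S_subset delete_vertex_S)

lemma quotient_complex_IC:
  "quotient_complex (chain_scale :: 'k::field \<Rightarrow> ('v, 'k) tens \<Rightarrow> _)
    (tensor_product_deg n Ks) (D_deg n Ks) (tensor_diff r n)"
proof unfold_locales
  fix t :: "('v, 'k) tens" and p
  show "t \<in> tensor_product_deg n Ks p \<Longrightarrow> tensor_diff r n t \<in> tensor_product_deg n Ks (p - 1)"
    unfolding tensor_product_deg_eq by (rule tensor_diff_tuples_deg)
  show "t \<in> D_deg n Ks p \<Longrightarrow> tensor_diff r n t \<in> D_deg n Ks (p - 1)"
    unfolding D_deg_eq
    by (erule tensor_diff_supported)
      (simp_all add: delete_vertex_tuples_deg delete_vertex_empty_tuples
        le_infI1 order.trans[OF tuples_deg_subset S_subset])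
  show "t \<in> tensor_product_deg n Ks p \<Longrightarrow> tensor_diff r n (tensor_diff r n t) = 0"
    unfolding tensor_product_deg_eq
    by (erule tensor_diff_tensor_diff[OF _ _ _ order])
      (simp_all only: order.trans[OF tuples_deg_subset S_subset] vertices_S
        subsetD[OF tuples_deg_subset])
qed (simp_all add: tensor_product_deg_eq D_deg_eq subspace_supported supported_mono)

interpretation IC: quotient_complex "chain_scale :: 'k::field \<Rightarrow> ('v, 'k) tens \<Rightarrow> _"
  "tensor_product_deg n Ks" "D_deg n Ks" "tensor_diff r n"
  by (rule quotient_complex_IC)

lemma IC_eq: "(IC n Ks :: int \<Rightarrow> ('k::field, ('v, 'k) tens set) module) = IC.quotient"
  by (simp add: fun_eq_iff IC_def IC.quotient_def tensor_module_def)

lemma IC_diff_eq: "(IC_diff r n Ks :: int \<Rightarrow> ('v, 'k::field) tens set \<Rightarrow> _) = IC.quotient_diff"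
  by (simp add: fun_eq_iff IC_diff_def IC.quotient_diff_def tensor_module_def)

lemma interaction_homology_eq:
  "(interaction_homology r n Ks p :: ('k::field, ('v, 'k) tens set set) module) =
    homology IC.quotient IC.quotient_diff (-1) p"
  by (simp add: interaction_homology_def IC_eq IC_diff_eq)

lemma carrier_IC_co_cochains:
  "(carrier (IC_co n Ks p) :: (('v, 'k::field) tens \<Rightarrow> 'k) set) = cochains n Ks p"
  by (rule carrier_IC_co) (rule simplicial)

section \<open>Cocycles, coboundaries and interaction cohomology\<close>

definition cocycles :: "int \<Rightarrow> (('v, 'k::field) tens \<Rightarrow> 'k) set" where
  "cocycles p = {f \<in> cochains n Ks p. \<forall>t\<in>supported (tuples_deg n Ks (p + 1)). f (tensor_diff r n t) = 0}"

definition coboundaries :: "int \<Rightarrow> (('v, 'k::field) tens \<Rightarrow> 'k) set" where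
  "coboundaries p = IC_codiff r n Ks (p - 1) ` cochains n Ks (p - 1)"

lemma IC_codiff_functional:
  assumes "f \<in> cochains n Ks p"
  shows "IC_codiff r n Ks p f \<in> (functionals S :: (('v, 'k::field) tens \<Rightarrow> 'k) set)"
proof -
  have f: "f \<in> functionals S" using assms by (simp add: cochains_def)
  have add: "f (x + y) = f x + f y" if "x \<in> supported S" "y \<in> supported S" for x y
    using f that unfolding functionals_iff by blast
  have scale: "f (chain_scale a x) = a * f x" if "x \<in> supported S" for a x
    using f that unfolding functionals_iff by blast
  show ?thesis
    unfolding functionals_iff
    by (intro conjI ballI allI impI)
      (simp_all add: IC_codiff_def tensor_product_eq tensor_diff.add tensor_diff.scale add scale
        tensor_diff_S chain.subspace_add[OF subspace_supported]
        chain.subspace_scale[OF subspace_supported] distrib_left mult.left_commute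
        del: One_nat_def)
qed

text \<open>A basis element of degree \<open>q\<close> has its boundary in degree
  \<open>q - 1\<close>, which differs from \<open>p\<close>, and \<open>f\<close> vanishes outside
  degree \<open>p\<close>.\<close>

lemma IC_codiff_single_other:
  assumes f: "f \<in> cochains n Ks p" and s: "s \<in> S" "s \<notin> tuples_deg n Ks (p + 1)"
  shows "IC_codiff r n Ks p f (Poly_Mapping.single s (1::'k::field)) = 0"
proof -
  define q where "q = (\<Sum>i=1..n. sdim (s i))"
  have "s \<in> tuples_deg n Ks q" using s(1) by (simp add: tuples_deg_def q_def)
  then have "tensor_diff r n (Poly_Mapping.single s (1::'k)) \<in> supported (tuples_deg n Ks (q - 1))"
    by (intro tensor_diff_tuples_deg) simp
  moreover have "q \<noteq> p + 1" using s by (auto simp: tuples_deg_def q_def)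
  ultimately have "f (tensor_diff r n (Poly_Mapping.single s (1::'k))) = 0"
    using tuples_deg_subset by (intro cochain_eq_0[OF f]) (auto simp: tuples_deg_def)
  then show ?thesis by (simp add: IC_codiff_def)
qed

text \<open>The sign in the codifferential is a unit, and \<open>IC_codiff_single_other\<close>
  settles the other degrees, so being a cocycle is a condition on chains of degree
  \<open>p + 1\<close> only.\<close>

lemma cycles_IC_co: "cycles (IC_co n Ks) (IC_codiff r n Ks) 1 p = (cocycles p :: (('v, 'k::field) tens \<Rightarrow> 'k) set)"
proof -
  have "IC_codiff r n Ks p f = 0 \<longleftrightarrow>
      (\<forall>t\<in>supported (tuples_deg n Ks (p + 1)). f (tensor_diff r n t) = 0)"
    if f: "f \<in> cochains n Ks p" for f :: "('v, 'k) tens \<Rightarrow> 'k"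
  proof
    have pm: "pm_one p \<noteq> (0::'k)" by (simp add: pm_one_def)
    assume *: "IC_codiff r n Ks p f = 0"
    show "\<forall>t\<in>supported (tuples_deg n Ks (p + 1)). f (tensor_diff r n t) = 0"
    proof
      fix t :: "('v, 'k) tens" assume "t \<in> supported (tuples_deg n Ks (p + 1))"
      then have "t \<in> tensor_product n Ks"
        unfolding tensor_product_eq using supported_mono[OF tuples_deg_subset] by blast
      then show "f (tensor_diff r n t) = 0"
        using fun_cong[OF *, of t] pm by (simp add: IC_codiff_def)
    qed
  next
    assume *: "\<forall>t\<in>supported (tuples_deg n Ks (p + 1)). f (tensor_diff r n t) = 0"
    show "IC_codiff r n Ks p f = 0"
    proof (rule functional_eqI[OF IC_codiff_functional[OF f]])
      show "0 \<in> functionals S" by (rule functional.subspace_0[OF subspace_functionals])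
      show "IC_codiff r n Ks p f (Poly_Mapping.single s 1) = 0 (Poly_Mapping.single s 1)"
        if "s \<in> S" for s
        using * IC_codiff_single_other[OF f that]
        by (cases "s \<in> tuples_deg n Ks (p + 1)") (auto simp: IC_codiff_def)
    qed
  qed
  moreover have "\<zero>\<^bsub>IC_co n Ks (p + 1)\<^esub> = (0 :: ('v, 'k) tens \<Rightarrow> 'k)" by (simp add: IC_co_def)
  ultimately show ?thesis
    unfolding cycles_def cocycles_def carrier_IC_co_cochains by auto
qed

lemma boundaries_IC_co:
  "boundaries (IC_co n Ks) (IC_codiff r n Ks) 1 p = (coboundaries p :: (('v, 'k::field) tens \<Rightarrow> 'k) set)"
  by (simp only: boundaries_def coboundaries_def carrier_IC_co_cochains)

lemma subspace_cocycles: "functional.subspace (cocycles p :: (('v, 'k::field) tens \<Rightarrow> 'k) set)"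
  using subspace_cochains[of n Ks p, where ?'k = 'k]
  unfolding functional.subspace_def cocycles_def by (auto simp: fun_scale_def)

lemma subspace_coboundaries:
  "functional.subspace (coboundaries p :: (('v, 'k::field) tens \<Rightarrow> 'k) set)"
  unfolding coboundaries_def by (rule IC_codiff.subspace_image[OF subspace_cochains])

lemma interaction_cohomology_eq:
  "(interaction_cohomology r n Ks p :: ('k::field, (('v, 'k) tens \<Rightarrow> 'k) set) module) =
    quotient_module (module_on (cocycles p) fun_scale) (coboundaries p)"
  unfolding interaction_cohomology_def homology_def cycles_IC_co boundaries_IC_co
  by (simp add: IC_co_def)

lemma cocycle_class_eq: "cocycle_class r n Ks p f = coset (coboundaries p) (f :: ('v, 'k::field) tens \<Rightarrow> 'k)"
  unfolding cocycle_class_def boundaries_IC_co by (simp add: IC_co_def a_r_coset_module_on)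

section \<open>The pairing of classes and its independence of choices\<close>

lemma cocycle_rel_boundary:
  assumes f: "f \<in> cocycles p" and t: "t \<in> IC.rel_boundaries p"
  shows "f t = (0::'k::field)"
proof -
  obtain u y where uy: "u \<in> supported (tuples_deg n Ks (p + 1))" "y \<in> D_deg n Ks p"
    "t = tensor_diff r n u + y"
    using t unfolding IC.rel_boundaries_def tensor_product_deg_eq by blast
  have "f y = 0"
    using f uy(2) tuples_deg_subset unfolding cocycles_def D_deg_eq
    by (intro cochain_eq_0[of f n Ks p]) auto
  moreover have "f (tensor_diff r n u) = 0" using f uy(1) by (auto simp: cocycles_def)
  moreover have "tensor_diff r n u \<in> supported S" "y \<in> supported S"
    using uy supported_mono[OF tuples_deg_subset] tensor_diff_S unfolding D_deg_eq supported_Int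
    by blast+
  ultimately show ?thesis
    using f unfolding uy(3) cocycles_def cochains_def functionals_iff by auto
qed

text \<open>Up to sign the value is that of a cochain at the boundary of \<open>t\<close>, which
  lies in \<open>D\<close>, where cochains vanish. This gives independence of the chosen
  cocycle.\<close>

lemma coboundary_rel_cycle:
  assumes g: "g \<in> coboundaries p" and t: "t \<in> IC.rel_cycles p"
  shows "g t = (0::'k::field)"
proof -
  obtain f where f: "f \<in> cochains n Ks (p - 1)" "g = IC_codiff r n Ks (p - 1) f"
    using g unfolding coboundaries_def by blast
  have "f (tensor_diff r n t) = 0"
    using t tuples_deg_subset unfolding IC.rel_cycles_def D_deg_eq
    by (intro cochain_eq_0[OF f(1)]) auto
  then show ?thesis by (simp add: f(2) IC_codiff_def)
qed

lemma rel_boundaries_subset_rel_cycles: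
  "(IC.rel_boundaries p :: ('v, 'k::field) tens set) \<subseteq> IC.rel_cycles p"
proof
  fix t :: "('v, 'k) tens" assume "t \<in> IC.rel_boundaries p"
  then obtain u y where uy: "u \<in> tensor_product_deg n Ks (p + 1)" "y \<in> D_deg n Ks p"
    "t = tensor_diff r n u + y" unfolding IC.rel_boundaries_def by blast
  then show "t \<in> IC.rel_cycles p"
    using IC.d_T[OF uy(1)] IC.D_T IC.d_D[OF uy(2)] IC.d_d[OF uy(1)]
      chain.subspace_add[OF IC.subspace_T, of "tensor_diff r n u" p y]
    by (auto simp: IC.rel_cycles_def tensor_diff.add)
qed

text \<open>The definite description in \<open>psi\<close> is meaningful because all cocycles,
  cycles and lifts in the two classes give one value.\<close>

lemma psi_class:
  assumes f: "f \<in> cocycles p" and t: "t \<in> IC.rel_cycles p"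
  shows "psi r n Ks p (coset (coboundaries p) f) (IC.homology_class p t) = (f t :: 'k::field)"
proof -
  have val: "f' t' = f t"
    if f': "f' \<in> coset (coboundaries p) f" and X: "X \<in> IC.homology_class p t" and t': "t' \<in> X"
    for f' X t'
  proof -
    obtain g where g: "g \<in> coboundaries p" "f' = g + f" using f' by (auto simp: coset_def)
    have b: "t' - t \<in> IC.rel_boundaries p" by (rule IC.homology_class_lift_diff[OF t' X])
    \<comment> \<open>Relative boundaries are relative cycles, so the other lift \<open>t'\<close>
      is a relative cycle too and the coboundary \<open>g\<close> vanishes on it.\<close>
    then have Z: "t' - t \<in> IC.rel_cycles p" using rel_boundaries_subset_rel_cycles by blast
    then have t'Z: "t' \<in> IC.rel_cycles p"
      using chain.subspace_add[OF IC.subspace_rel_cycles Z t] by simp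
    have S: "t \<in> supported S" "t' - t \<in> supported S"
      using t Z supported_mono[OF tuples_deg_subset] unfolding IC.rel_cycles_def tensor_product_deg_eq
      by blast+
    have "f ((t' - t) + t) = f (t' - t) + f t"
      using f S unfolding cocycles_def cochains_def functionals_iff by blast
    then have "f t' = f t" using cocycle_rel_boundary[OF f b] by simp
    then show ?thesis using coboundary_rel_cycle[OF g(1) t'Z] by (simp add: g(2))
  qed
  have "f \<in> coset (coboundaries p) f"
    using functional.subspace_0[OF subspace_coboundaries] by (force simp: coset_def)
  then have "(THE a. \<exists>f'\<in>coset (coboundaries p) f. \<exists>X\<in>IC.homology_class p t. \<exists>t'\<in>X. a = f' t') = f t"
    using val IC.homology_class_lift[of p t] by (intro the_equality) blast+
  moreover have "IC.homology_class p t \<in> carrier (interaction_homology r n Ks p)"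
    using t by (simp add: interaction_homology_eq IC.carrier_homology)
  ultimately show ?thesis by (simp add: psi_def)
qed

lemma psi_outside: "Z \<notin> carrier (interaction_homology r n Ks p) \<Longrightarrow> psi r n Ks p F Z = 0"
  by (simp add: psi_def)

text \<open>The selected relative cycle depends on \<open>Z\<close> alone and not on
  \<open>f\<close>, so linearity of \<open>psi\<close> can be read off pointwise.\<close>

lemma psi_class_if:
  "f \<in> cocycles p \<Longrightarrow> psi r n Ks p (coset (coboundaries p) f) =
    (\<lambda>Z. if Z \<in> carrier (interaction_homology r n Ks p)
      then f (SOME t. t \<in> IC.rel_cycles p \<and> Z = IC.homology_class p t) else (0::'k::field))"
proof
  fix Z :: "('v, 'k) tens set set"
  assume f: "f \<in> cocycles p"
  let ?t = "SOME t. t \<in> IC.rel_cycles p \<and> Z = IC.homology_class p t"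
  show "psi r n Ks p (coset (coboundaries p) f) Z =
    (if Z \<in> carrier (interaction_homology r n Ks p) then f ?t else 0)"
  proof (cases "Z \<in> carrier (interaction_homology r n Ks p)")
    case True
    then have "\<exists>t. t \<in> IC.rel_cycles p \<and> Z = IC.homology_class p t"
      by (auto simp: interaction_homology_eq IC.carrier_homology)
    then have t: "?t \<in> IC.rel_cycles p \<and> Z = IC.homology_class p ?t" by (rule someI_ex)
    show ?thesis
      using True psi_class[OF f conjunct1[OF t]] conjunct2[OF t] by simp
  qed (simp add: psi_outside)
qed

section \<open>Bijectivity of \<open>psi\<close> onto the dual\<close>

lemma psi_in_dual:
  assumes f: "f \<in> cocycles p"
  shows "psi r n Ks p (coset (coboundaries p) (f :: ('v, 'k::field) tens \<Rightarrow> 'k)) \<in>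
    carrier (dual_module (interaction_homology r n Ks p))"
proof -
  have add: "f (t + t') = f t + f t'" and scale: "f (chain_scale a t) = a * f t"
    if "t \<in> IC.rel_cycles p" "t' \<in> IC.rel_cycles p" for t t' a
  proof -
    have "t \<in> supported S" "t' \<in> supported S"
      using that supported_mono[OF tuples_deg_subset]
      unfolding IC.rel_cycles_def tensor_product_deg_eq by blast+
    then show "f (t + t') = f t + f t'" "f (chain_scale a t) = a * f t"
      using f unfolding cocycles_def cochains_def functionals_iff by blast+
  qed
  show ?thesis
    unfolding dual_module_iff interaction_homology_eq IC.carrier_homology
  proof (intro conjI allI ballI impI; (elim imageE)?; hypsubst?)
    fix t t' :: "('v, 'k) tens" assume t: "t \<in> IC.rel_cycles p" and t': "t' \<in> IC.rel_cycles p"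
    show "psi r n Ks p (coset (coboundaries p) f) (IC.homology_class p t
        \<oplus>\<^bsub>homology IC.quotient IC.quotient_diff (- 1) p\<^esub> IC.homology_class p t') =
      psi r n Ks p (coset (coboundaries p) f) (IC.homology_class p t) +
      psi r n Ks p (coset (coboundaries p) f) (IC.homology_class p t')"
      using psi_class[OF f] t t' add chain.subspace_add[OF IC.subspace_rel_cycles t t']
      by (simp add: IC.add_homology)
  next
    fix a and t :: "('v, 'k) tens" assume t: "t \<in> IC.rel_cycles p"
    show "psi r n Ks p (coset (coboundaries p) f) (a
        \<odot>\<^bsub>homology IC.quotient IC.quotient_diff (- 1) p\<^esub> IC.homology_class p t) =
      a * psi r n Ks p (coset (coboundaries p) f) (IC.homology_class p t)"
      using psi_class[OF f] t scale chain.subspace_scale[OF IC.subspace_rel_cycles t]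
      by (simp add: IC.smult_homology)
  next
    fix Z assume "Z \<notin> IC.homology_class p ` (IC.rel_cycles p :: ('v, 'k) tens set)"
    then show "psi r n Ks p (coset (coboundaries p) f) Z = 0"
      by (intro psi_outside) (simp add: interaction_homology_eq IC.carrier_homology)
  qed
qed

text \<open>The core of injectivity. A chain of degree \<open>p\<close> whose boundary lies in
  \<open>D\<close> is a relative cycle, so the hypothesis is the kernel condition of
  \<open>linear_factor\<close> for the differential. The resulting \<open>g\<close>, cut off to
  degree \<open>p - 1\<close>, is an interaction cochain because it vanishes on
  \<open>D\<close>.\<close>

lemma coboundaryI:
  assumes h: "h \<in> cochains n Ks p" and zero: "\<And>t. t \<in> IC.rel_cycles p \<Longrightarrow> h t = 0"
  shows "h \<in> (coboundaries p :: (('v, 'k::field) tens \<Rightarrow> 'k) set)"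
proof -
  have S_deg: "t \<in> supported S" if "t \<in> supported (tuples_deg n Ks p)" for t :: "('v, 'k) tens"
    using that supported_mono[OF tuples_deg_subset] by blast
  have h_lin: "h (x + y) = h x + h y" "h (chain_scale a x) = a * h x"
    if "x \<in> supported S" "y \<in> supported S" for x y a
    using h that unfolding cochains_def functionals_iff by blast+
  obtain g where g: "Vector_Spaces.linear chain_scale (*) g"
    "\<And>t. t \<in> supported (tuples_deg n Ks p) \<Longrightarrow> g (tensor_diff r n t) = h t"
    "\<And>t. t \<in> D_deg n Ks (p - 1) \<Longrightarrow> g t = 0"
  proof (rule functional_extension.linear_factor[OF IC.linear_d
        subspace_supported[of "tuples_deg n Ks p"] IC.subspace_D[of "p - 1"], where f = h])
    show "h t = 0" if "t \<in> supported (tuples_deg n Ks p)" "tensor_diff r n t \<in> D_deg n Ks (p - 1)" for t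
      using that by (intro zero) (simp add: IC.rel_cycles_def tensor_product_deg_eq)
  qed (auto intro: h_lin S_deg)
  \<comment> \<open>The factor \<open>- pm_one (p - 1)\<close> cancels against the same factor in
    the codifferential.\<close>
  define G where "G = functional_of S
    (\<lambda>s. if s \<in> tuples_deg n Ks (p - 1) then - pm_one (p - 1) * g (Poly_Mapping.single s 1) else 0)"
  have G: "G \<in> cochains n Ks (p - 1)"
    unfolding cochains_def G_def
    by (auto simp: functional_of_in_functionals g(3) D_deg_eq simp del: One_nat_def split: if_splits)
  have "IC_codiff r n Ks (p - 1) G = h"
  proof (rule functional_eqI[OF IC_codiff_functional[OF G]])
    show "h \<in> functionals S" using h by (simp add: cochains_def)
    fix s assume s: "s \<in> S"
    show "IC_codiff r n Ks (p - 1) G (Poly_Mapping.single s 1) = h (Poly_Mapping.single s 1)"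
    proof (cases "s \<in> tuples_deg n Ks p")
      case True
      then have "tensor_diff r n (Poly_Mapping.single s (1::'k)) \<in> supported (tuples_deg n Ks (p - 1))"
        by (intro tensor_diff_tuples_deg) simp
      then have "G (tensor_diff r n (Poly_Mapping.single s 1)) =
          - pm_one (p - 1) * h (Poly_Mapping.single s 1)"
        using functional_of_linear[OF g(1) _ tuples_deg_subset] g(2) True unfolding G_def by simp
      then show ?thesis
        using s pm_one_sq[of "p - 1", where ?'k = 'k]
        by (simp add: IC_codiff_def tensor_product_eq mult.assoc[symmetric] del: One_nat_def)
    next
      case False
      then have "h (Poly_Mapping.single s 1) = 0" using h s unfolding cochains_def by blast
      then show ?thesis using IC_codiff_single_other[OF G s] False by simp
    qed
  qed
  then show ?thesis using G unfolding coboundaries_def by blast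
qed

lemma psi_inj:
  assumes f: "f \<in> cocycles p" and f': "f' \<in> cocycles p"
    and eq: "psi r n Ks p (coset (coboundaries p) f) =
      psi r n Ks p (coset (coboundaries p) (f' :: ('v, 'k::field) tens \<Rightarrow> 'k))"
  shows "coset (coboundaries p) f = coset (coboundaries p) f'"
proof -
  have "f - f' \<in> cochains n Ks p"
    using functional.subspace_diff[OF subspace_cochains] f f' unfolding cocycles_def by blast
  moreover have "(f - f') t = 0" if "t \<in> IC.rel_cycles p" for t
    using fun_cong[OF eq, of "IC.homology_class p t"] psi_class[OF f that] psi_class[OF f' that]
    by simp
  ultimately show ?thesis
    by (simp add: functional.coset_eq_iff[OF subspace_coboundaries] coboundaryI)
qed

text \<open>Pulled back to relative cycles, the functional kills relative boundaries, and
  \<open>linear_factor\<close> for the identity map extends it to all chains with the same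
  vanishing. The extension, cut off to degree \<open>p\<close>, is the cocycle sought.\<close>

lemma psi_surj:
  assumes \<Phi>: "\<Phi> \<in> carrier (dual_module
    (interaction_homology r n Ks p :: ('k::field, ('v, 'k) tens set set) module))"
  obtains f where "f \<in> cocycles p" "psi r n Ks p (coset (coboundaries p) f) = \<Phi>"
proof -
  define \<phi> where "\<phi> t = \<Phi> (IC.homology_class p t)" for t
  note dual = \<Phi>[unfolded dual_module_iff interaction_homology_eq IC.carrier_homology]
  have \<phi>_add: "\<phi> (x + y) = \<phi> x + \<phi> y" if "x \<in> IC.rel_cycles p" "y \<in> IC.rel_cycles p" for x y
    using dual that unfolding \<phi>_def by (simp add: IC.add_homology)
  have \<phi>_scale: "\<phi> (chain_scale a x) = a * \<phi> x" if "x \<in> IC.rel_cycles p" for a x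
    using dual that unfolding \<phi>_def by (simp add: IC.smult_homology)
  obtain g where g: "Vector_Spaces.linear chain_scale (*) g"
    "\<And>t. t \<in> IC.rel_cycles p \<Longrightarrow> g t = \<phi> t"
    "\<And>t. t \<in> IC.rel_boundaries p \<Longrightarrow> g t = 0"
  proof (rule functional_extension.linear_factor[OF chain.linear_ident
        IC.subspace_rel_cycles[of p] IC.subspace_rel_boundaries[of p], where f = \<phi>])
    fix t :: "('v, 'k) tens" assume t: "t \<in> IC.rel_boundaries p"
    \<comment> \<open>A relative boundary represents the same class as 0.\<close>
    have "\<phi> t = \<phi> 0"
      unfolding \<phi>_def using IC.homology_class_eqI[of t 0 p] t by simp
    then show "\<phi> t = 0"
      using \<phi>_scale[OF chain.subspace_0[OF IC.subspace_rel_cycles], of 0] by simp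
  qed (auto intro: \<phi>_add \<phi>_scale)
  define f where "f = functional_of S
    (\<lambda>s. if s \<in> tuples_deg n Ks p then 1 * g (Poly_Mapping.single s 1) else 0)"
  have f_eq: "f t = g t" if "t \<in> supported (tuples_deg n Ks p)" for t
    using functional_of_linear[OF g(1) that tuples_deg_subset, of 1] by (simp add: f_def)
  \<comment> \<open>Both parts of a relative boundary are used separately: the part from
    \<open>D\<close>, with boundary term 0, makes \<open>f\<close> an interaction cochain, and the
    boundary term, with part from \<open>D\<close> equal to 0, makes it a cocycle.\<close>
  have D: "t \<in> IC.rel_boundaries p" if "t \<in> D_deg n Ks p" for t :: "('v, 'k) tens"
    unfolding IC.rel_boundaries_def
    using that chain.subspace_0[OF IC.subspace_T, of "p + 1"] tensor_diff.zero add_0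
    by (smt (verit) mem_Collect_eq)
  have d: "tensor_diff r n t \<in> IC.rel_boundaries p"
    if "t \<in> tensor_product_deg n Ks (p + 1)" for t :: "('v, 'k) tens"
    unfolding IC.rel_boundaries_def
    using that chain.subspace_0[OF IC.subspace_D, of p] add_0_right
    by (smt (verit) mem_Collect_eq)
  have "f \<in> cochains n Ks p"
    unfolding cochains_def f_def
    by (auto simp: functional_of_in_functionals g(3) D D_deg_eq simp del: One_nat_def split: if_splits)
  moreover have "f (tensor_diff r n t) = 0" if "t \<in> supported (tuples_deg n Ks (p + 1))" for t
    using that tensor_diff_tuples_deg[OF that] d[of t] by (simp add: f_eq g(3) tensor_product_deg_eq)
  ultimately have f: "f \<in> cocycles p" by (simp add: cocycles_def)
  have "psi r n Ks p (coset (coboundaries p) f) Z = \<Phi> Z" for Z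
  proof (cases "Z \<in> carrier (interaction_homology r n Ks p)")
    case True
    then obtain t where t: "t \<in> IC.rel_cycles p" "Z = IC.homology_class p t"
      by (auto simp: interaction_homology_eq IC.carrier_homology)
    then show ?thesis
      using psi_class[OF f t(1)] g(2)[OF t(1)]
      by (simp add: f_eq \<phi>_def IC.rel_cycles_def tensor_product_deg_eq)
  next
    case False
    then show ?thesis using \<Phi> by (simp add: psi_outside dual_module_iff)
  qed
  then show ?thesis using that[OF f] by blast
qed

theorem psi_lin_iso:
  "psi r n Ks p \<in> lin_iso
    (interaction_cohomology r n Ks p :: ('k::field, (('v, 'k) tens \<Rightarrow> 'k) set) module)
    (dual_module (interaction_homology r n Ks p))"
proof -
  have carrier: "carrier (interaction_cohomology r n Ks p :: ('k, (('v, 'k) tens \<Rightarrow> 'k) set) module) =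
      coset (coboundaries p) ` cocycles p"
    by (simp only: interaction_cohomology_eq carrier_quotient_module)
  have "psi r n Ks p (coset (coboundaries p) f \<oplus>\<^bsub>interaction_cohomology r n Ks p\<^esub>
      coset (coboundaries p) f') =
    psi r n Ks p (coset (coboundaries p) f) + psi r n Ks p (coset (coboundaries p) f')"
    if "f \<in> cocycles p" "f' \<in> cocycles p" for f f' :: "('v, 'k) tens \<Rightarrow> 'k"
    using that functional.subspace_add[OF subspace_cocycles that]
    by (simp add: interaction_cohomology_eq functional.add_quotient_module[OF subspace_coboundaries]
        psi_class_if fun_eq_iff)
  moreover have "psi r n Ks p (a \<odot>\<^bsub>interaction_cohomology r n Ks p\<^esub> coset (coboundaries p) f) =
      fun_scale a (psi r n Ks p (coset (coboundaries p) f))"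
    if "f \<in> cocycles p" for a and f :: "('v, 'k) tens \<Rightarrow> 'k"
    using that functional.subspace_scale[OF subspace_cocycles that]
    by (simp add: interaction_cohomology_eq functional.smult_quotient_module[OF subspace_coboundaries]
        psi_class_if fun_scale_def fun_eq_iff)
  moreover have "bij_betw (psi r n Ks p)
      (carrier (interaction_cohomology r n Ks p :: ('k, (('v, 'k) tens \<Rightarrow> 'k) set) module))
      (carrier (dual_module (interaction_homology r n Ks p)))"
    unfolding bij_betw_def carrier
  proof (intro conjI inj_onI equalityI subsetI)
    fix \<Phi> assume "\<Phi> \<in> carrier (dual_module
      (interaction_homology r n Ks p :: ('k, ('v, 'k) tens set set) module))"
    then show "\<Phi> \<in> psi r n Ks p ` coset (coboundaries p) ` cocycles p"
      by (rule psi_surj) blast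
  qed (auto dest: psi_inj intro: psi_in_dual)
  ultimately show ?thesis
    using psi_in_dual[of _ p, where ?'k = 'k]
    unfolding lin_iso_def lin_hom_def hom_def carrier
    by (auto simp: dual_module_def carrier)
qed

theorem psi_cocycle_class:
  assumes f: "f \<in> cycles (IC_co n Ks) (IC_codiff r n Ks) 1 p"
    and z: "z \<in> cycles (IC n Ks) (IC_diff r n Ks) (-1) p" and t: "t \<in> z"
  shows "psi r n Ks p (cocycle_class r n Ks p f) (cycle_class r n Ks p z) = (f t :: 'k::field)"
proof -
  obtain u where u: "u \<in> IC.rel_cycles p" "z = coset (D_deg n Ks p) u"
    using z unfolding IC_eq IC_diff_eq IC.cycles_quotient by blast
  obtain y where y: "y \<in> D_deg n Ks p" "t = y + u"
    using t u by (auto simp: coset_def)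
  have f': "f \<in> cocycles p" using f by (simp add: cycles_IC_co)
  \<comment> \<open>The formula concerns an arbitrary lift \<open>t\<close> of \<open>z\<close>. It
    differs from the relative cycle \<open>u\<close> by an element of \<open>D\<close>, so it is
    itself a relative cycle and represents the same coset.\<close>
  have "t \<in> IC.rel_cycles p"
    unfolding y(2) using y(1) IC.D_T IC.d_D[OF y(1)]
    by (intro chain.subspace_add[OF IC.subspace_rel_cycles] u(1)) (auto simp: IC.rel_cycles_def)
  moreover have "z = coset (D_deg n Ks p) t"
    using y by (simp add: u(2) chain.coset_eq_iff[OF IC.subspace_D] chain.subspace_neg[OF IC.subspace_D])
  ultimately show ?thesis
    by (simp add: cocycle_class_eq cycle_class_def IC_eq IC_diff_eq IC.class_quotient psi_class[OF f'])
qed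

end

theorem theorem4p3:
  fixes n :: nat and K :: "'v set set" and Ks :: "nat \<Rightarrow> 'v set set"
    and r :: "'v rel" and p :: int
  assumes "interaction_complex n K Ks"
    and "linear_order_on (\<Union>K) r"
  shows "psi r n Ks p \<in> lin_iso
           (interaction_cohomology r n Ks p :: ('k::field, (('v, 'k) tens \<Rightarrow> 'k) set) module)
           (dual_module (interaction_homology r n Ks p)) \<and>
         (\<forall>f :: ('v, 'k) tens \<Rightarrow> 'k. \<forall>z t.
           f \<in> cycles (IC_co n Ks) (IC_codiff r n Ks) 1 p \<longrightarrow>
           z \<in> cycles (IC n Ks) (IC_diff r n Ks) (-1) p \<longrightarrow> t \<in> z \<longrightarrow>
           psi r n Ks p (cocycle_class r n Ks p f) (cycle_class r n Ks p z) = f t)"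
proof -
  interpret oriented_interaction_complex n K Ks r
    using assms by unfold_locales
  show ?thesis using psi_lin_iso psi_cocycle_class by blast
qed

end
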